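(* Let $r,s\in\mathbb{N}$ with $s\le r$ and let $1\le p<\infty$. Let $(G_W)_{W>0}$ be linear operators of the form $G_W(f)(x)=\sum_{k=-\infty}^{+\infty} f(x_{k,W})\varphi_{k,W}(x)$. Assume that there are constants $K_1=K_1(p)>0$ and $K_3=K_3(s,p)>0$ (independent of $f$ and $W$) such that for all $W>0$ $$\|G_W(f)\|_p\le K_1\|f\|_{\ell_p(\Sigma_W)}\quad (f\in\Lambda^p),\qquad \|f-G_W(f)\|_p\le K_3W^{-s}\|f^{(s)}\|_p\quad (f\in W^s_p(\mathbb{R})).$$ Then there is a constant $C_1>0$, not depending on $f$ and $W$, such that for every $f\in\Lambda^p$ and every $W>0$ $$\|f-G_W(f)\|_p\le K_1\|\tilde f_{1/W,r}-f\|_{\ell_p(\Sigma_W)}+C_1\,\omega_s(f,1/W)_p,$$ and in particular $$\|f-G_W(f)\|_p\le\max\{K_1,C_1\}\,\tilde\Omega_{r,s}\left(f,\tfrac1W,\Sigma_W\right)_p.$$ Moreover, if in addition there is a constant $K_2=K_2(p)>0$ with $K_2\|f\|_{\ell_p(\Sigma_W)}\le\|G_W(f)\|_p$ for all $f\in\Lambda^p$ and $W>0$, then for every $f\in\Lambda^p$ and $W>0$ $$K_2\|\tilde f_{1/W,r}-f\|_{\ell_p(\Sigma_W)}-C_1\,\omega_s(f,1/W)_p\le\|f-G_W(f)\|_p .$$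
   Context: Conventions: $\mathbb{N}=\{1,2,\dots\}$; functions are defined pointwise (functions equal almost everywhere are not identified); $\|\cdot\|_p$ is the $L^p(\mathbb{R})$ norm. $W^s_p(\mathbb{R})$ is the usual Sobolev space, whose elements are taken as functions $g\in L^p(\mathbb{R})$ with $g,\dots,g^{(s-1)}$ locally absolutely continuous and $g^{(s)}\in L^p(\mathbb{R})$. In the definition of $G_W$, $x_{k,W}\in\mathbb{R}$ are nodes and $\varphi_{k,W}$ are functions on $\mathbb{R}$; the series is understood to converge, so that $G_W$ is a well-defined linear operator on $\Lambda^p$. $M(\mathbb{R})$ is the set of bounded measurable functions on $\mathbb{R}$. A sequence $\Sigma=(x_j)_{j\in\mathbb{Z}}\subset\mathbb{R}$ is admissible if $0<\inf_j(x_j-x_{j-1})\le\sup_j(x_j-x_{j-1})<\infty$; put $\|f\|_{\ell_p(\Sigma)}=\big(\sum_{j\in\mathbb{Z}}|f(x_j)|^p(x_j-x_{j-1})\big)^{1/p}$. $\Lambda^p=\{f\in M(\mathbb{R}):\|f\|_{\ell_p(\Sigma)}<\infty\text{ for every admissible }\Sigma\}$; one has $W^s_p(\mathbb{R})\subset\Lambda^p\subset L^p(\mathbb{R})$. $\Sigma_W=(j/W)_{j\in\mathbb{Z}}$, so $\|f\|_{\ell_p(\Sigma_W)}=\big(\frac1W\sum_{j\in\mathbb{Z}}|f(j/W)|^p\big)^{1/p}$. Modulus of smoothness: $\Delta_h^s f(x)=\sum_{k=0}^s\binom sk(-1)^{s-k}f(x+kh)$, $\omega_s(f,\delta)_p=\sup_{0<h\le\delta}\|\Delta_h^sf\|_p$.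 Steklov averages ($\delta>0$): $\tilde f_{\delta,r}(x)=(-\delta)^{-r}\int_0^\delta\cdots\int_0^\delta\sum_{m=1}^r(-1)^{r-m+1}\binom rm f\big(x+\frac mr(t_1+\dots+t_r)\big)\,dt_1\cdots dt_r$. Semi-discrete modulus: $\tilde\Omega_{r,s}(f,\frac1W,\Sigma_W)_p=\|\tilde f_{1/W,r}-f\|_{\ell_p(\Sigma_W)}+\omega_s(f,1/W)_p$. *)

theory Defs
  imports "HOL-Analysis.Analysis"
begin

text \<open>
  Functions take values in \<open>'a :: {real_normed_field, euclidean_space}\<close>, which covers real-valued
  and complex-valued functions at once. They are plain functions (no identification almost
  everywhere), ``measurable'' means Lebesgue measurable, and norms are extended
  nonnegative reals, so that no integrability side conditions are hidden in their values.
\<close>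

definition ennreal_powr :: "ennreal \<Rightarrow> real \<Rightarrow> ennreal" where
  "ennreal_powr x q = (if x = \<infinity> then \<infinity> else ennreal (enn2real x powr q))"

text \<open>
  The norm is \<open>\<infinity>\<close> exactly off \<open>L\<^sup>p(\<real>)\<close>. In particular a nonmeasurable function
  has norm \<open>\<infinity>\<close>, whereas its \<open>nn_integral\<close> alone would only be a lower integral. Hence
  a finite bound on \<open>Lp_norm p g\<close> includes the measurability of \<open>g\<close>.
\<close>
definition Lp_norm :: "real \<Rightarrow> (real \<Rightarrow> 'a::{real_normed_field, euclidean_space}) \<Rightarrow> ennreal" where
  "Lp_norm p g =
     (if g \<in> borel_measurable lebesgue
      then ennreal_powr (\<integral>\<^sup>+ x. ennreal (norm (g x) powr p) \<partial>lebesgue) (1 / p)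
      else \<infinity>)"

definition in_Lp :: "real \<Rightarrow> (real \<Rightarrow> 'a::{real_normed_field, euclidean_space}) \<Rightarrow> bool" where
  "in_Lp p g \<longleftrightarrow> Lp_norm p g < \<infinity>"

definition abs_continuous_on_interval ::
    "real \<Rightarrow> real \<Rightarrow> (real \<Rightarrow> 'a::real_normed_vector) \<Rightarrow> bool" where
  "abs_continuous_on_interval a b g \<longleftrightarrow>
     (\<forall>\<epsilon>>0. \<exists>\<delta>>0. \<forall>(n::nat) u v.
        (\<forall>i<n. a \<le> u i \<and> u i \<le> v i \<and> v i \<le> b) \<and>
        disjoint_family_on (\<lambda>i. {u i<..<v i}) {..<n} \<and>
        (\<Sum>i<n. v i - u i) < \<delta>
        \<longrightarrow> (\<Sum>i<n. norm (g (v i) - g (u i))) < \<epsilon>)"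

definition locally_abs_continuous :: "(real \<Rightarrow> 'a::real_normed_vector) \<Rightarrow> bool" where
  "locally_abs_continuous g \<longleftrightarrow> (\<forall>a b. a \<le> b \<longrightarrow> abs_continuous_on_interval a b g)"

text \<open>
  At points where the preceding derivative is not differentiable, \<open>vector_derivative\<close> has a
  fixed unspecified value. For \<open>g\<close> in the Sobolev space of order \<open>s\<close> defined below
  this affects the derivative of order \<open>s\<close> on a null set only.
\<close>
definition nth_deriv :: "nat \<Rightarrow> (real \<Rightarrow> 'a::real_normed_vector) \<Rightarrow> real \<Rightarrow> 'a" where
  "nth_deriv j g = ((\<lambda>h x. vector_derivative h (at x)) ^^ j) g"

text \<open>
  The derivatives of order below \<open>s\<close> exist everywhere; the one of order \<open>s\<close> exists almost
  everywhere because the one of order \<open>s - 1\<close> is locally absolutely continuous.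
\<close>
definition sobolev ::
    "nat \<Rightarrow> real \<Rightarrow> (real \<Rightarrow> 'a::{real_normed_field, euclidean_space}) set" where
  "sobolev s p =
     {g. in_Lp p g \<and>
         (\<forall>j x. Suc j < s \<longrightarrow> nth_deriv j g differentiable (at x)) \<and>
         (\<forall>j<s. locally_abs_continuous (nth_deriv j g)) \<and>
         in_Lp p (nth_deriv s g)}"

definition bounded_measurable :: "(real \<Rightarrow> 'a::{real_normed_field, euclidean_space}) set" where
  "bounded_measurable = {f. f \<in> borel_measurable lebesgue \<and> bounded (range f)}"

definition admissible :: "(int \<Rightarrow> real) \<Rightarrow> bool" where
  "admissible \<Sigma> \<longleftrightarrow>
     0 < (INF j. ereal (\<Sigma> j - \<Sigma> (j - 1))) \<and> (SUP j. ereal (\<Sigma> j - \<Sigma> (j - 1))) < \<infinity>"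

definition lp_norm ::
    "real \<Rightarrow> (int \<Rightarrow> real) \<Rightarrow> (real \<Rightarrow> 'a::{real_normed_field, euclidean_space}) \<Rightarrow> ennreal" where
  "lp_norm p \<Sigma> f =
     ennreal_powr (\<Sum>\<^sub>\<infinity>j\<in>UNIV. ennreal (norm (f (\<Sigma> j)) powr p * (\<Sigma> j - \<Sigma> (j - 1)))) (1 / p)"

definition Lambda_space ::
    "real \<Rightarrow> (real \<Rightarrow> 'a::{real_normed_field, euclidean_space}) set" where
  "Lambda_space p =
     {f \<in> bounded_measurable. \<forall>\<Sigma>. admissible \<Sigma> \<longrightarrow> lp_norm p \<Sigma> f < \<infinity>}"

definition grid :: "real \<Rightarrow> int \<Rightarrow> real" where
  "grid W j = of_int j / W"

definition difference ::
    "nat \<Rightarrow> real \<Rightarrow> (real \<Rightarrow> 'a::{real_normed_field, euclidean_space}) \<Rightarrow> real \<Rightarrow> 'a" where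
  "difference s h f x = (\<Sum>k=0..s. of_nat (s choose k) * (-1) ^ (s - k) * f (x + of_nat k * h))"

definition modulus ::
    "nat \<Rightarrow> real \<Rightarrow> (real \<Rightarrow> 'a::{real_normed_field, euclidean_space}) \<Rightarrow> real \<Rightarrow> ennreal" where
  "modulus s p f \<delta> = (SUP h\<in>{0<..\<delta>}. Lp_norm p (difference s h f))"

text \<open>
  \<open>iterated_integral \<delta> n F\<close> is the \<open>n\<close>-fold integral over \<open>{0..\<delta>}\<close> in each variable of
  \<open>F [t\<^sub>1, \<dots>, t\<^sub>n]\<close>. It is iterated rather than taken over a product measure: for merely
  Lebesgue measurable \<open>f\<close>, \<open>(t, u) \<mapsto> f (t + u)\<close> need not be measurable for the (incomplete)
  product sigma-algebra.
\<close>
primrec iterated_integral ::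
    "real \<Rightarrow> nat \<Rightarrow> (real list \<Rightarrow> 'a) \<Rightarrow> 'a::{real_normed_field, euclidean_space}" where
  "iterated_integral \<delta> 0 F = F []"
| "iterated_integral \<delta> (Suc n) F =
     (LINT t:{0..\<delta>}|lebesgue. iterated_integral \<delta> n (\<lambda>ts. F (t # ts)))"

definition steklov ::
    "nat \<Rightarrow> real \<Rightarrow> (real \<Rightarrow> 'a::{real_normed_field, euclidean_space}) \<Rightarrow> real \<Rightarrow> 'a" where
  "steklov r \<delta> f x =
     ((- \<delta>) powi (- int r)) *\<^sub>R
     iterated_integral \<delta> r
       (\<lambda>ts. \<Sum>m=1..r. (-1) ^ (r - m + 1) * of_nat (r choose m) *
                        f (x + real m / real r * sum_list ts))"

definition semidiscrete_modulus ::
    "nat \<Rightarrow> nat \<Rightarrow> real \<Rightarrow> (real \<Rightarrow> 'a::{real_normed_field, euclidean_space}) \<Rightarrow> real \<Rightarrow>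
     (int \<Rightarrow> real) \<Rightarrow> ennreal" where
  "semidiscrete_modulus r s p f \<delta> \<Sigma> =
     lp_norm p \<Sigma> (\<lambda>x. steklov r \<delta> f x - f x) + modulus s p f \<delta>"

text \<open>
  Convergence of a two-sided series: both tails tend to infinity independently, and convergence
  need not be absolute.
\<close>
definition bilateral_sums :: "(int \<Rightarrow> 'a::real_normed_vector) \<Rightarrow> 'a \<Rightarrow> bool" where
  "bilateral_sums a S \<longleftrightarrow>
     ((\<lambda>(m, n). \<Sum>k\<in>{- int m..int n}. a k) \<longlongrightarrow> S) (sequentially \<times>\<^sub>F sequentially)"

definition sampling_operators ::
    "real \<Rightarrow> (real \<Rightarrow> int \<Rightarrow> real) \<Rightarrow> (real \<Rightarrow> int \<Rightarrow> real \<Rightarrow> 'a) \<Rightarrow>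
     (real \<Rightarrow> (real \<Rightarrow> 'a) \<Rightarrow> real \<Rightarrow> 'a::{real_normed_field, euclidean_space}) \<Rightarrow> bool" where
  "sampling_operators p node \<phi> G \<longleftrightarrow>
     (\<forall>W>0. \<forall>f\<in>Lambda_space p. \<forall>x.
        bilateral_sums (\<lambda>k. f (node W k) * \<phi> W k x) (G W f x))"

end

theory Submission
  imports Defs
begin

text \<open>
  Write \<open>\<delta> = 1 / W\<close> and let \<open>S\<close> be the Steklov average \<open>steklov r \<delta> f\<close>. The theorem rests on the
  splitting
  \<open>f - G f = (f - S) + (S - G S) + G (S - f)\<close>.
  The Steklov average is a smooth proxy for \<open>f\<close>. The last term is bounded by \<open>K1\<close> times the
  discrete norm of \<open>S - f\<close>; the first two are of the order of \<open>modulus s p f \<delta>\<close>, for the following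
  reasons.

  The first term: the coefficients of the Steklov average are those of a finite difference with
  the term \<open>m = 0\<close> removed, so \<open>f x - S x\<close> is, up to sign, the average over
  \<open>t\<^sub>1, \<dots>, t\<^sub>r \<in> {0..\<delta>}\<close> of the difference of order \<open>r\<close> of \<open>f\<close> with step \<open>(t\<^sub>1 + \<dots> + t\<^sub>r) / r\<close>,
  a step of at most \<open>\<delta>\<close> (\<open>minus_steklov_eq_iterated_difference\<close>). By Minkowski's integral
  inequality (\<open>Lp_norm_set_integral_le\<close>) its norm is at most the modulus of order \<open>r\<close>, and each
  order above \<open>s\<close> costs a factor \<open>2\<close>.

  The second term: the direct estimate for Sobolev functions reduces it to \<open>W\<close> to the power \<open>-s\<close>
  times the norm of the derivative of \<open>S\<close> of order \<open>s\<close>. The average \<open>S\<close> is a combination of the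
  \<open>r\<close>-th iterates of the operators \<open>h \<mapsto> (\<integral> t \<in> {0..\<delta>}. h (x + c t))\<close> with \<open>c = m / r\<close>. One
  differentiation turns one such integral into a difference quotient with step \<open>c \<delta>\<close>, so the
  derivative of order \<open>s\<close> consists of \<open>r - s\<close> integrals applied to the difference of order \<open>s\<close>; the
  powers of \<open>\<delta>\<close> cancel those of \<open>W\<close> and the modulus of order \<open>s\<close> remains
  (\<open>Lp_norm_steklov_deriv_le\<close>). If \<open>s = r\<close>, no integral is left over and the last derivative exists
  only almost everywhere, by Lebesgue differentiation (\<open>bounded_borel_primitive\<close>).

  Two points need care. To apply \<open>G\<close> to \<open>S\<close> and to use its linearity, \<open>S\<close> must lie in
  \<open>Lambda_space p\<close>; this space is closed under passing to a function that at each point is dominated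
  by a value of the given function within a bounded distance (\<open>Lambda_space_dominated\<close>). And \<open>f\<close> is only
  Lebesgue measurable, so \<open>f (x + t)\<close> need not be jointly measurable in \<open>x\<close> and \<open>t\<close>; but the
  Steklov average, unlike the discrete norm, does not change when \<open>f\<close> is replaced by a Borel
  function that is equal to it almost everywhere.

  The lower estimate uses the same splitting, solved for \<open>G (S - f)\<close>.
\<close>

section \<open>The Lebesgue norm\<close>

text \<open>
  The only convexity input: both Minkowski inequalities below follow from this tangent line bound.
\<close>
lemma powr_above_tangent:
  fixes a y p :: real
  assumes "1 \<le> p" "0 < a" "0 \<le> y"
  shows "a powr p + p * a powr (p - 1) * (y - a) \<le> y powr p"
proof (cases "y = 0")
  case True
  have "a powr (p - 1) * a = a powr p"
    using assms by (simp add: powr_diff)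
  then have "a powr p + p * a powr (p - 1) * (0 - a) = (1 - p) * a powr p"
    by (simp add: algebra_simps)
  also have "\<dots> \<le> 0"
    using assms by (simp add: mult_nonpos_nonneg)
  finally show ?thesis
    using True by simp
next
  case False
  have "(\<lambda>x. x powr p) y - a powr p \<ge> (p * a powr (p - 1)) * (y - a)"
    using assms False
    by (intro convex_on_imp_above_tangent[OF powr_convex])
       (auto intro!: derivative_eq_intros simp: interior_open has_field_derivative_at_within)
  then show ?thesis
    by simp
qed

text \<open>
  Take the tangent at the convex combination and average the two bounds at \<open>u\<close> and \<open>v\<close>; the linear
  terms cancel. Unlike \<open>powr_convex\<close>, this includes the boundary point \<open>0\<close>.
\<close>
lemma convex_combination_powr_le:
  fixes u v l p :: real
  assumes "1 \<le> p" "0 \<le> u" "0 \<le> v" "0 \<le> l" "l \<le> 1"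
  shows "(l * u + (1 - l) * v) powr p \<le> l * u powr p + (1 - l) * v powr p"
proof (cases "l * u + (1 - l) * v = 0")
  case True
  then show ?thesis
    using assms by simp
next
  case False
  define c where "c = l * u + (1 - l) * v"
  have "c > 0"
    using False assms by (simp add: c_def add_nonneg_nonneg less_le)
  have u: "l * (c powr p + p * c powr (p - 1) * (u - c)) \<le> l * u powr p"
    using powr_above_tangent[OF \<open>1 \<le> p\<close> \<open>c > 0\<close> \<open>0 \<le> u\<close>] assms by (intro mult_left_mono)
  have v: "(1 - l) * (c powr p + p * c powr (p - 1) * (v - c)) \<le> (1 - l) * v powr p"
    using powr_above_tangent[OF \<open>1 \<le> p\<close> \<open>c > 0\<close> \<open>0 \<le> v\<close>] assms by (intro mult_left_mono) auto
  have "l * (c powr p + p * c powr (p - 1) * (u - c)) + (1 - l) * (c powr p + p * c powr (p - 1) * (v - c))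
      = c powr p + p * c powr (p - 1) * (l * u + (1 - l) * v - c)"
    by (simp add: algebra_simps)
  then show ?thesis
    using u v by (simp add: c_def)
qed

text \<open>
  This removes the root: a finite bound is a bound on the integral together with measurability.
\<close>
lemma Lp_norm_le_iff:
  assumes "1 \<le> p" "0 \<le> M"
  shows "Lp_norm p g \<le> ennreal M \<longleftrightarrow>
    g \<in> borel_measurable lebesgue \<and>
    (\<integral>\<^sup>+ x. ennreal (norm (g x) powr p) \<partial>lebesgue) \<le> ennreal (M powr p)"
proof -
  have "ennreal_powr I (1 / p) \<le> ennreal M \<longleftrightarrow> I \<le> ennreal (M powr p)" for I
  proof (cases I)
    case (real t)
    have "t powr (1 / p) \<le> M \<longleftrightarrow> t \<le> M powr p"
    proof
      assume "t powr (1 / p) \<le> M"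
      then have "(t powr (1 / p)) powr p \<le> M powr p"
        using assms by (intro powr_mono2) auto
      then show "t \<le> M powr p"
        using assms real by (simp add: powr_powr)
    next
      assume "t \<le> M powr p"
      then have "t powr (1 / p) \<le> (M powr p) powr (1 / p)"
        using assms real by (intro powr_mono2) auto
      then show "t powr (1 / p) \<le> M"
        using assms real by (simp add: powr_powr)
    qed
    then show ?thesis
      using real assms by (simp add: ennreal_powr_def)
  qed (auto simp: ennreal_powr_def top_unique)
  then show ?thesis
    by (auto simp: Lp_norm_def top_unique)
qed

lemma Lp_norm_eq_ennrealD:
  assumes "1 \<le> p" "Lp_norm p f = ennreal a" "0 \<le> a"
  shows "(\<integral>\<^sup>+ x. ennreal (norm (f x) powr p) \<partial>lebesgue) \<le> ennreal (a powr p)"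
    and "f \<in> borel_measurable lebesgue"
  using Lp_norm_le_iff[of p a f] assms by auto

lemma Lp_norm_cong_AE:
  assumes "f \<in> borel_measurable lebesgue" "g \<in> borel_measurable lebesgue"
    and "AE x in lebesgue. f x = g x"
  shows "Lp_norm p f = Lp_norm p g"
proof -
  have "(\<integral>\<^sup>+ x. ennreal (norm (f x) powr p) \<partial>lebesgue) = (\<integral>\<^sup>+ x. ennreal (norm (g x) powr p) \<partial>lebesgue)"
    using assms(3) by (intro nn_integral_cong_AE) auto
  then show ?thesis
    using assms by (simp add: Lp_norm_def)
qed

lemma in_Lp_measurable: "in_Lp p f \<Longrightarrow> f \<in> borel_measurable lebesgue"
  by (auto simp: in_Lp_def Lp_norm_def split: if_splits)

lemma Lp_norm_zero:
  assumes "1 \<le> p" shows "Lp_norm p (\<lambda>x. 0) = 0"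
  using Lp_norm_le_iff[OF assms, of 0 "\<lambda>x. 0"] by simp

lemma Lp_norm_zero_AE:
  assumes "1 \<le> p" "Lp_norm p f = 0"
  shows "AE x in lebesgue. f x = 0"
proof -
  have f: "f \<in> borel_measurable lebesgue"
      "(\<integral>\<^sup>+ x. ennreal (norm (f x) powr p) \<partial>lebesgue) = 0"
    using assms Lp_norm_le_iff[of p 0 f] by auto
  have "AE x in lebesgue. ennreal (norm (f x) powr p) = 0"
    using f by (subst (asm) nn_integral_0_iff_AE) auto
  then show ?thesis
    by eventually_elim (use assms in \<open>simp add: ennreal_eq_0_iff\<close>)
qed

text \<open>
  With \<open>a\<close> and \<open>b\<close> the norms of \<open>f\<close> and \<open>g\<close>, the sum \<open>norm (f x) + norm (g x)\<close> is \<open>a + b\<close> times a convex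
  combination of \<open>norm (f x) / a\<close> and \<open>norm (g x) / b\<close>. Convexity of the power then gives a pointwise
  bound whose integral is at most \<open>(a + b) powr p\<close>.
\<close>
lemma Lp_norm_add:
  fixes f g :: "real \<Rightarrow> 'a::{real_normed_field, euclidean_space}"
  assumes p: "1 \<le> p"
  shows "Lp_norm p (\<lambda>x. f x + g x) \<le> Lp_norm p f + Lp_norm p g"
proof (cases "Lp_norm p f = \<infinity> \<or> Lp_norm p g = \<infinity>")
  case True
  then show ?thesis
    by auto
next
  case False
  then obtain a b where a: "Lp_norm p f = ennreal a" "0 \<le> a"
    and b: "Lp_norm p g = ennreal b" "0 \<le> b"
    by (cases "Lp_norm p f"; cases "Lp_norm p g") auto
  note f = Lp_norm_eq_ennrealD[OF p a] and g = Lp_norm_eq_ennrealD[OF p b]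
  note [measurable] = f(2) g(2)
  show ?thesis
  proof (cases "a = 0 \<or> b = 0")
    case True
    then show ?thesis
    proof
      assume "a = 0"
      then have "AE x in lebesgue. f x + g x = g x"
        using Lp_norm_zero_AE[OF p, of f] a by auto
      then have "Lp_norm p (\<lambda>x. f x + g x) = Lp_norm p g"
        by (intro Lp_norm_cong_AE) auto
      then show ?thesis
        by simp
    next
      assume "b = 0"
      then have "AE x in lebesgue. f x + g x = f x"
        using Lp_norm_zero_AE[OF p, of g] b by auto
      then have "Lp_norm p (\<lambda>x. f x + g x) = Lp_norm p f"
        by (intro Lp_norm_cong_AE) auto
      then show ?thesis
        by simp
    qed
  next
    case False
    with a b have ab: "a > 0" "b > 0"
      by auto
    (* The weight for which both normalised functions enter the convex combination. *)
    define l where "l = a / (a + b)"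
    have l: "0 \<le> l" "l \<le> 1" "1 - l = b / (a + b)"
      using ab by (auto simp: l_def field_simps)
    have pointwise: "norm (f x + g x) powr p \<le>
        (a + b) powr p * l / a powr p * norm (f x) powr p +
        (a + b) powr p * (1 - l) / b powr p * norm (g x) powr p" for x
    proof -
      have "norm (f x + g x) \<le> (a + b) * (l * (norm (f x) / a) + (1 - l) * (norm (g x) / b))"
        using ab norm_triangle_ineq[of "f x" "g x"] unfolding l(3) by (simp add: l_def distrib_left)
      then have "norm (f x + g x) powr p \<le>
          ((a + b) * (l * (norm (f x) / a) + (1 - l) * (norm (g x) / b))) powr p"
        using p by (intro powr_mono2) auto
      also have "\<dots> = (a + b) powr p * (l * (norm (f x) / a) + (1 - l) * (norm (g x) / b)) powr p"
        using ab l by (intro powr_mult)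
      also have "\<dots> \<le> (a + b) powr p *
          (l * (norm (f x) / a) powr p + (1 - l) * (norm (g x) / b) powr p)"
        using ab l p by (intro mult_left_mono convex_combination_powr_le) auto
      finally show ?thesis
        using ab by (simp add: powr_divide algebra_simps)
    qed
    define A B where "A = (a + b) powr p * l / a powr p" and "B = (a + b) powr p * (1 - l) / b powr p"
    have AB: "0 \<le> A" "0 \<le> B"
      using ab l(1,2) by (auto simp: A_def B_def)
    have AB_sum: "A * a powr p + B * b powr p = (a + b) powr p"
      using ab by (simp add: A_def B_def field_simps)
    have "(\<integral>\<^sup>+ x. ennreal (norm (f x + g x) powr p) \<partial>lebesgue)
        \<le> (\<integral>\<^sup>+ x. ennreal A * ennreal (norm (f x) powr p) + ennreal B * ennreal (norm (g x) powr p) \<partial>lebesgue)"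
      using AB pointwise[folded A_def B_def]
      by (intro nn_integral_mono) (simp flip: ennreal_mult ennreal_plus)
    also have "\<dots> = ennreal A * (\<integral>\<^sup>+ x. ennreal (norm (f x) powr p) \<partial>lebesgue)
        + ennreal B * (\<integral>\<^sup>+ x. ennreal (norm (g x) powr p) \<partial>lebesgue)"
      by (subst nn_integral_add) (auto simp: nn_integral_cmult)
    also have "\<dots> \<le> ennreal A * ennreal (a powr p) + ennreal B * ennreal (b powr p)"
      by (intro add_mono mult_left_mono f g) auto
    also have "\<dots> = ennreal ((a + b) powr p)"
      using AB AB_sum by (simp flip: ennreal_mult ennreal_plus)
    finally have "Lp_norm p (\<lambda>x. f x + g x) \<le> ennreal (a + b)"
      using ab p by (subst Lp_norm_le_iff) auto
    then show ?thesis
      using a b by simp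
  qed
qed

lemma Lp_norm_cmult_le:
  fixes f :: "real \<Rightarrow> 'a::{real_normed_field, euclidean_space}"
  assumes p: "1 \<le> p"
  shows "Lp_norm p (\<lambda>x. c * f x) \<le> ennreal (norm c) * Lp_norm p f"
proof (cases "Lp_norm p f")
  case (real a)
  note f = Lp_norm_eq_ennrealD[OF p real(2,1)]
  note [measurable] = f(2)
  have "(\<integral>\<^sup>+ x. ennreal (norm (c * f x) powr p) \<partial>lebesgue)
      = ennreal (norm c powr p) * (\<integral>\<^sup>+ x. ennreal (norm (f x) powr p) \<partial>lebesgue)"
    by (simp add: norm_mult powr_mult ennreal_mult nn_integral_cmult)
  also have "\<dots> \<le> ennreal (norm c powr p) * ennreal (a powr p)"
    by (intro mult_left_mono f) auto
  also have "\<dots> = ennreal ((norm c * a) powr p)"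
    using real by (simp add: powr_mult flip: ennreal_mult)
  finally have "Lp_norm p (\<lambda>x. c * f x) \<le> ennreal (norm c * a)"
    using p real by (subst Lp_norm_le_iff) auto
  then show ?thesis
    using real by (simp add: ennreal_mult)
next
  case top
  show ?thesis
  proof (cases "c = 0")
    case True
    then show ?thesis
      using Lp_norm_zero[OF p, where ?'a='a] by simp
  next
    case False
    then show ?thesis
      using top by (simp add: ennreal_mult_top)
  qed
qed

lemma Lp_norm_scaleR_le:
  fixes f :: "real \<Rightarrow> 'a::{real_normed_field, euclidean_space}"
  assumes "1 \<le> p"
  shows "Lp_norm p (\<lambda>x. c *\<^sub>R f x) \<le> ennreal \<bar>c\<bar> * Lp_norm p f"
  using Lp_norm_cmult_le[OF assms, of "of_real c" f] by (simp add: scaleR_conv_of_real)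

lemma Lp_norm_minus: "Lp_norm p (\<lambda>x. - f x) = Lp_norm p f"
proof -
  have "(\<lambda>x. - f x) \<in> borel_measurable lebesgue \<longleftrightarrow> f \<in> borel_measurable lebesgue"
    using borel_measurable_uminus[of f lebesgue] borel_measurable_uminus[of "\<lambda>x. - f x" lebesgue] by auto
  then show ?thesis
    by (simp add: Lp_norm_def)
qed

lemma Lp_norm_diff:
  fixes f g :: "real \<Rightarrow> 'a::{real_normed_field, euclidean_space}"
  assumes "1 \<le> p"
  shows "Lp_norm p (\<lambda>x. f x - g x) \<le> Lp_norm p f + Lp_norm p g"
  using Lp_norm_add[OF assms, of f "\<lambda>x. - g x"] by (simp add: Lp_norm_minus)

lemma Lp_norm_sum:
  fixes f :: "'i \<Rightarrow> real \<Rightarrow> 'a::{real_normed_field, euclidean_space}"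
  assumes "1 \<le> p" "finite I"
  shows "Lp_norm p (\<lambda>x. \<Sum>i\<in>I. f i x) \<le> (\<Sum>i\<in>I. Lp_norm p (f i))"
  using assms(2)
proof (induction I)
  case empty
  then show ?case
    using Lp_norm_zero[OF assms(1), where ?'a='a] by simp
next
  case (insert i I)
  then show ?case
    using Lp_norm_add[OF assms(1), of "f i" "\<lambda>x. \<Sum>i\<in>I. f i x"]
    by (simp add: order.trans add_left_mono)
qed

lemma measurable_real_affine_lebesgue:
  fixes f :: "real \<Rightarrow> 'b::topological_space"
  assumes "c \<noteq> 0" "f \<in> borel_measurable lebesgue"
  shows "(\<lambda>x. f (t + c * x)) \<in> borel_measurable lebesgue"
  using lebesgue_affine_measurable[where c = "\<lambda>x::real. c" and t = t] assms
  by (intro measurable_compose[of "\<lambda>x. t + c * x" lebesgue lebesgue f]) (auto simp: mult.commute)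

lemma Lp_norm_translate:
  fixes f :: "real \<Rightarrow> 'a::{real_normed_field, euclidean_space}"
  assumes "f \<in> borel_measurable lebesgue"
  shows "Lp_norm p (\<lambda>x. f (x + a)) = Lp_norm p f"
proof -
  have m: "(\<lambda>x. f (x + a)) \<in> borel_measurable lebesgue"
    using measurable_real_affine_lebesgue[of 1 f a] assms by (simp add: add.commute)
  have [measurable]: "f \<in> borel_measurable lebesgue" by fact
  have "(\<integral>\<^sup>+ x. ennreal (norm (f x) powr p) \<partial>lebesgue) = (\<integral>\<^sup>+ x. ennreal (norm (f (x + a)) powr p) \<partial>lebesgue)"
    by (subst nn_integral_real_affine_lebesgue[of _ 1 a]) (auto simp: add.commute)
  then show ?thesis
    using m assms by (simp add: Lp_norm_def)
qed

section \<open>Minkowski's integral inequality\<close>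

lemma set_integrable_bounded_interval:
  fixes h :: "real \<Rightarrow> 'a::{banach, second_countable_topology}"
  assumes "h \<in> borel_measurable lebesgue" "\<And>t. norm (h t) \<le> B"
  shows "set_integrable lebesgue {a..b} h"
  unfolding set_integrable_def
proof (rule Bochner_Integration.integrable_bound)
  show "integrable lebesgue (\<lambda>t. indicator {a..b} t *\<^sub>R B)"
    by (intro integrable_completion[THEN iffD2] integrable_scaleR_left integrable_real_indicator)
       (auto simp: emeasure_lborel_Icc_eq)
  show "(\<lambda>t. indicator {a..b} t *\<^sub>R h t) \<in> borel_measurable lebesgue"
    using assms(1) by (intro borel_measurable_scaleR borel_measurable_indicator) auto
  show "AE t in lebesgue. norm (indicator {a..b} t *\<^sub>R h t) \<le> norm (indicator {a..b} t *\<^sub>R B)"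
    using assms(2) by (intro AE_I2) (auto simp: indicator_def intro: order.trans[OF _ abs_ge_self])
qed

text \<open>
  If \<open>h\<close> is not integrable, the integral has the default value \<open>0\<close>, which satisfies the bound as well.
\<close>
lemma norm_set_integral_interval_le:
  fixes h :: "real \<Rightarrow> 'a::{banach, second_countable_topology}"
  assumes "0 \<le> d" "0 \<le> B" "\<And>t. t \<in> {0..d} \<Longrightarrow> norm (h t) \<le> B"
  shows "norm (LINT t:{0..d}|lebesgue. h t) \<le> d * B"
proof (cases "set_integrable lebesgue {0..d} h")
  case True
  have "norm (LINT t:{0..d}|lebesgue. h t) \<le> (LINT t:{0..d}|lebesgue. B)"
    unfolding set_lebesgue_integral_def
  proof (intro Bochner_Integration.integral_norm_bound_integral)
    show "integrable lebesgue (\<lambda>t. indicator {0..d} t *\<^sub>R B)"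
      by (intro integrable_completion[THEN iffD2] integrable_scaleR_left integrable_real_indicator)
         (auto simp: emeasure_lborel_Icc_eq)
  qed (use True assms in \<open>auto simp: set_integrable_def indicator_def\<close>)
  also have "\<dots> = d * B"
    using assms by (simp add: set_lebesgue_integral_def)
  finally show ?thesis .
next
  case False
  then show ?thesis
    using assms by (simp add: set_lebesgue_integral_def set_integrable_def not_integrable_integral_eq)
qed

text \<open>
  Jensen's inequality on \<open>{0..d}\<close>: integrate the tangent line bound taken at the mean of \<open>norm (h t)\<close>.
\<close>
lemma norm_set_integral_powr_le:
  fixes h :: "real \<Rightarrow> 'a::{banach, second_countable_topology}"
  assumes p: "1 \<le> p" and "0 < d"
    and meas: "h \<in> borel_measurable lebesgue" and B: "\<And>t. norm (h t) \<le> B"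
  shows "norm (LINT t:{0..d}|lebesgue. h t) powr p
    \<le> d powr (p - 1) * (LINT t:{0..d}|lebesgue. norm (h t) powr p)"
proof -
  let ?I = "\<lambda>f. (LINT t:{0..d}|lebesgue. f t) :: real"
  define m where "m = ?I (\<lambda>t. norm (h t))"
  have [measurable]: "h \<in> borel_measurable lebesgue" by fact
  have "0 \<le> B"
    using B[of 0] norm_ge_zero order.trans by blast
  have int1: "set_integrable lebesgue {0..d} (\<lambda>t. norm (h t))"
    using B by (intro set_integrable_bounded_interval[where B = B]) auto
  have intp: "set_integrable lebesgue {0..d} (\<lambda>t. norm (h t) powr p)"
    using B p by (intro set_integrable_bounded_interval[where B = "B powr p"]) (auto intro!: powr_mono2)
  have intc: "set_integrable lebesgue {0..d} (\<lambda>t. c)" for c :: real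
    by (intro set_integrable_bounded_interval[where B = "\<bar>c\<bar>"]) auto
  have const: "?I (\<lambda>t. c) = d * c" for c
    using \<open>0 < d\<close> by (simp add: set_lebesgue_integral_def)
  have le: "norm (LINT t:{0..d}|lebesgue. h t) \<le> m"
    unfolding m_def set_lebesgue_integral_def
    using integral_norm_bound[of lebesgue "\<lambda>t. indicator {0..d} t *\<^sub>R h t"] by (simp add: abs_mult)
  show ?thesis
  proof (cases "m > 0")
    case False
    then have "norm (LINT t:{0..d}|lebesgue. h t) = 0"
      using le norm_ge_zero[of "LINT t:{0..d}|lebesgue. h t"] by linarith
    moreover have "0 \<le> ?I (\<lambda>t. norm (h t) powr p)"
      unfolding set_lebesgue_integral_def by (intro Bochner_Integration.integral_nonneg) auto
    ultimately show ?thesis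
      using p by simp
  next
    case True
    define a where "a = m / d"
    have "a > 0"
      using True \<open>0 < d\<close> by (simp add: a_def)
    define k where "k = p * a powr (p - 1)"
    have "d * a powr p = ?I (\<lambda>t. (a powr p - k * a) + k * norm (h t))"
    proof -
      have "?I (\<lambda>t. (a powr p - k * a) + k * norm (h t)) = d * (a powr p - k * a) + k * m"
        using int1 intc by (subst set_integral_add) (auto simp: const m_def)
      also have "\<dots> = d * a powr p"
        using \<open>0 < d\<close> by (simp add: a_def algebra_simps)
      finally show ?thesis by simp
    qed
    also have "\<dots> \<le> ?I (\<lambda>t. norm (h t) powr p)"
    proof (rule set_integral_mono)
      show "set_integrable lebesgue {0..d} (\<lambda>t. (a powr p - k * a) + k * norm (h t))"
        using int1 intc by (intro set_integral_add) auto
      show "a powr p - k * a + k * norm (h t) \<le> norm (h t) powr p" for t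
        using powr_above_tangent[OF p \<open>a > 0\<close> norm_ge_zero[of "h t"]] by (simp add: k_def algebra_simps)
    qed (fact intp)
    finally have *: "d * a powr p \<le> ?I (\<lambda>t. norm (h t) powr p)" .
    have "norm (LINT t:{0..d}|lebesgue. h t) powr p \<le> m powr p"
      using le p by (intro powr_mono2) auto
    also have "\<dots> = d powr (p - 1) * (d * a powr p)"
      using \<open>0 < d\<close> True by (simp add: a_def powr_divide powr_diff)
    also have "\<dots> \<le> d powr (p - 1) * ?I (\<lambda>t. norm (h t) powr p)"
      using * by (intro mult_left_mono) auto
    finally show ?thesis .
  qed
qed

lemma borel_measurable_parametric_set_integral:
  fixes H :: "'b::second_countable_topology \<Rightarrow> real \<Rightarrow> 'a::{banach, second_countable_topology}"
  assumes [measurable]: "case_prod H \<in> borel_measurable borel"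
  shows "(\<lambda>x. LINT t:{0..d}|lebesgue. H x t) \<in> borel_measurable borel"
proof -
  have "sets (borel \<Otimes>\<^sub>M lborel :: ('b \<times> real) measure) = sets (borel :: ('b \<times> real) measure)"
    by (metis borel_prod sets_lborel sets_pair_measure_cong)
  then have 1: "case_prod H \<in> borel_measurable (borel \<Otimes>\<^sub>M lborel)"
    using assms measurable_cong_sets by blast
  have [measurable]: "(\<lambda>t. H x t) \<in> borel_measurable borel" for x
    using measurable_Pair2[OF 1] by simp
  have "(LINT t:{0..d}|lebesgue. H x t) = (LINT t|lborel. indicator {0..d} t *\<^sub>R H x t)" for x
    unfolding set_lebesgue_integral_def by (rule integral_completion) measurable
  moreover have "(\<lambda>x. LINT t|lborel. indicator {0..d} t *\<^sub>R H x t) \<in> borel_measurable borel"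
  proof (intro lborel.borel_measurable_lebesgue_integral)
    have "(\<lambda>z. indicat_real {0..d} (snd z)) \<in> borel_measurable (borel \<Otimes>\<^sub>M lborel)"
      by measurable
    then show "(\<lambda>(x, t). indicator {0..d} t *\<^sub>R H x t) \<in> borel_measurable (borel \<Otimes>\<^sub>M lborel)"
      using borel_measurable_scaleR[OF _ 1] by (simp add: split_beta')
  qed
  ultimately show ?thesis
    by simp
qed

text \<open>
  Jensen's inequality bounds the power of the inner integral pointwise, and Tonelli's theorem exchanges
  the two integrations. Joint Borel measurability makes the exchange legitimate, and the uniform
  bound makes every integral in \<open>t\<close> exist.
\<close>
lemma Lp_norm_set_integral_le:
  fixes H :: "real \<Rightarrow> real \<Rightarrow> 'a::{real_normed_field, euclidean_space}"
  assumes p: "1 \<le> p" and "0 < d"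
    and H: "case_prod H \<in> borel_measurable borel" and B: "\<And>x t. norm (H x t) \<le> B"
    and M: "\<And>t. t \<in> {0..d} \<Longrightarrow> Lp_norm p (\<lambda>x. H x t) \<le> M"
  shows "Lp_norm p (\<lambda>x. LINT t:{0..d}|lebesgue. H x t) \<le> ennreal d * M"
proof (cases M)
  case top
  then show ?thesis
    using \<open>0 < d\<close> by (simp add: ennreal_mult_top)
next
  case (real m)
  let ?F = "\<lambda>x. LINT t:{0..d}|lebesgue. H x t"
  have HB: "case_prod H \<in> borel_measurable (lborel \<Otimes>\<^sub>M lborel)"
    using H by (simp add: lborel_prod)
  note [measurable] = HB
  have H1 [measurable]: "(\<lambda>t. H x t) \<in> borel_measurable borel" for x
    using measurable_Pair2[OF HB] by simp
  have H2 [measurable]: "(\<lambda>x. H x t) \<in> borel_measurable borel" for t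
    using measurable_Pair1[OF HB] by simp
  have "?F \<in> borel_measurable borel"
    by (rule borel_measurable_parametric_set_integral[OF H])
  then have F: "?F \<in> borel_measurable lebesgue"
    by (intro measurable_completion) simp
  have slice: "(\<integral>\<^sup>+x. ennreal (norm (H x t) powr p) \<partial>lborel) \<le> ennreal (m powr p)" if "t \<in> {0..d}" for t
    using M[OF that] real p by (simp add: Lp_norm_le_iff nn_integral_completion)
  have pt: "ennreal (norm (?F x) powr p)
      \<le> ennreal (d powr (p - 1)) * (\<integral>\<^sup>+t. indicator {0..d} t * ennreal (norm (H x t) powr p) \<partial>lborel)" for x
  proof -
    have meas: "(\<lambda>t. H x t) \<in> borel_measurable lebesgue"
      by (intro measurable_completion) simp
    have "norm (H x t) powr p \<le> B powr p" for t
      using B p by (intro powr_mono2) auto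
    then have "set_integrable lebesgue {0..d} (\<lambda>t. norm (H x t) powr p)"
      using meas by (intro set_integrable_bounded_interval[where B = "B powr p"]) auto
    then have "ennreal (LINT t:{0..d}|lebesgue. norm (H x t) powr p)
        = (\<integral>\<^sup>+t. ennreal (indicator {0..d} t *\<^sub>R norm (H x t) powr p) \<partial>lebesgue)"
      unfolding set_lebesgue_integral_def set_integrable_def
      by (intro nn_integral_eq_integral[symmetric]) (auto simp: indicator_def)
    also have "\<dots> = (\<integral>\<^sup>+t. indicator {0..d} t * ennreal (norm (H x t) powr p) \<partial>lborel)"
      unfolding nn_integral_completion by (intro nn_integral_cong) (auto simp: indicator_def)
    finally have eq: "ennreal (LINT t:{0..d}|lebesgue. norm (H x t) powr p) = \<dots>" .
    have "ennreal (norm (?F x) powr p)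
        \<le> ennreal (d powr (p - 1) * (LINT t:{0..d}|lebesgue. norm (H x t) powr p))"
      using norm_set_integral_powr_le[OF p \<open>0 < d\<close> meas B] by (intro ennreal_leI)
    also have "\<dots> = ennreal (d powr (p - 1)) * ennreal (LINT t:{0..d}|lebesgue. norm (H x t) powr p)"
      unfolding set_lebesgue_integral_def
      by (intro ennreal_mult Bochner_Integration.integral_nonneg) auto
    finally show ?thesis
      unfolding eq .
  qed
  have "(\<integral>\<^sup>+ x. ennreal (norm (?F x) powr p) \<partial>lebesgue)
      \<le> (\<integral>\<^sup>+ x. ennreal (d powr (p - 1)) * (\<integral>\<^sup>+t. indicator {0..d} t * ennreal (norm (H x t) powr p) \<partial>lborel) \<partial>lborel)"
    unfolding nn_integral_completion by (intro nn_integral_mono pt)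
  also have "\<dots> = ennreal (d powr (p - 1)) *
      (\<integral>\<^sup>+ x. (\<integral>\<^sup>+t. indicator {0..d} t * ennreal (norm (H x t) powr p) \<partial>lborel) \<partial>lborel)"
    by (intro nn_integral_cmult) measurable
  also have "(\<integral>\<^sup>+ x. (\<integral>\<^sup>+t. indicator {0..d} t * ennreal (norm (H x t) powr p) \<partial>lborel) \<partial>lborel)
      = (\<integral>\<^sup>+ t. (\<integral>\<^sup>+x. indicator {0..d} t * ennreal (norm (H x t) powr p) \<partial>lborel) \<partial>lborel)"
    by (intro lborel_pair.Fubini'[symmetric]) measurable
  also have "\<dots> = (\<integral>\<^sup>+ t. indicator {0..d} t * (\<integral>\<^sup>+x. ennreal (norm (H x t) powr p) \<partial>lborel) \<partial>lborel)"
    by (intro nn_integral_cong nn_integral_cmult) measurable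
  also have "\<dots> \<le> (\<integral>\<^sup>+ t. ennreal (m powr p) * indicator {0..d} t \<partial>lborel)"
    using slice by (intro nn_integral_mono) (auto simp: indicator_def)
  also have "\<dots> = ennreal (m powr p) * ennreal d"
    using \<open>0 < d\<close> by (simp add: nn_integral_cmult)
  also have "ennreal (d powr (p - 1)) * (ennreal (m powr p) * ennreal d) = ennreal ((d * m) powr p)"
    using \<open>0 < d\<close> real by (simp add: powr_mult powr_diff flip: ennreal_mult)
  finally have "(\<integral>\<^sup>+ x. ennreal (norm (?F x) powr p) \<partial>lebesgue) \<le> ennreal ((d * m) powr p)"
    by (simp add: mult_left_mono)
  then have "Lp_norm p ?F \<le> ennreal (d * m)"
    using F p \<open>0 < d\<close> real by (subst Lp_norm_le_iff) auto
  then show ?thesis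
    using real \<open>0 < d\<close> by (simp add: ennreal_mult)
qed

section \<open>Functions with finite discrete norms\<close>

lemma ennreal_powr_less_top_iff: "ennreal_powr x q < \<infinity> \<longleftrightarrow> x < \<infinity>"
  by (auto simp: ennreal_powr_def less_top)

lemma infsum_ennreal_less_top_iff:
  fixes a :: "'i \<Rightarrow> real"
  assumes "\<And>i. 0 \<le> a i"
  shows "(\<Sum>\<^sub>\<infinity>i\<in>A. ennreal (a i)) < \<infinity> \<longleftrightarrow> a summable_on A"
proof
  assume "a summable_on A"
  then have "ennreal (infsum a A) = (SUP F\<in>{F. finite F \<and> F \<subseteq> A}. ennreal (sum a F))"
    using assms by (intro infsum_nonneg_is_SUPREMUM_ennreal) auto
  also have "\<dots> = (\<Sum>\<^sub>\<infinity>i\<in>A. ennreal (a i))"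
    by (subst nonneg_infsum_complete) (auto simp: assms intro!: SUP_cong)
  finally show "(\<Sum>\<^sub>\<infinity>i\<in>A. ennreal (a i)) < \<infinity>"
    by (metis ennreal_less_top infinity_ennreal_def)
next
  assume fin: "(\<Sum>\<^sub>\<infinity>i\<in>A. ennreal (a i)) < \<infinity>"
  then obtain b where b: "(\<Sum>\<^sub>\<infinity>i\<in>A. ennreal (a i)) = ennreal b" "0 \<le> b"
    by (cases "\<Sum>\<^sub>\<infinity>i\<in>A. ennreal (a i)") auto
  have "sum a F \<le> b" if "finite F" "F \<subseteq> A" for F
  proof -
    have "ennreal (sum a F) = (\<Sum>i\<in>F. ennreal (a i))"
      using assms by simp
    also have "\<dots> \<le> (SUP F\<in>{F. finite F \<and> F \<subseteq> A}. \<Sum>i\<in>F. ennreal (a i))"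
      using that by (intro SUP_upper) auto
    also have "\<dots> = (\<Sum>\<^sub>\<infinity>i\<in>A. ennreal (a i))"
      by (subst nonneg_infsum_complete) auto
    finally show ?thesis
      using b by simp
  qed
  then show "a summable_on A"
    using assms by (intro nonneg_bdd_above_summable_on) (auto intro!: bdd_aboveI)
qed

lemma admissible_iff:
  "admissible \<Sigma> \<longleftrightarrow> (\<exists>d>0. \<exists>D. \<forall>j. d \<le> \<Sigma> j - \<Sigma> (j - 1) \<and> \<Sigma> j - \<Sigma> (j - 1) \<le> D)"
proof
  assume "admissible \<Sigma>"
  then have inf: "0 < (INF j. ereal (\<Sigma> j - \<Sigma> (j - 1)))"
    and sup: "(SUP j. ereal (\<Sigma> j - \<Sigma> (j - 1))) < \<infinity>"
    by (auto simp: admissible_def)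
  from ereal_dense2[OF inf] obtain d
    where d: "0 < ereal d" "ereal d < (INF j. ereal (\<Sigma> j - \<Sigma> (j - 1)))"
    by auto
  from ereal_dense2[OF sup] obtain D where D: "(SUP j. ereal (\<Sigma> j - \<Sigma> (j - 1))) < ereal D"
    by auto
  have "ereal d < ereal (\<Sigma> j - \<Sigma> (j - 1))" for j
    using d(2) by (rule less_le_trans) (auto intro: INF_lower)
  moreover have "ereal (\<Sigma> j - \<Sigma> (j - 1)) < ereal D" for j
    by (rule le_less_trans[OF _ D]) (auto intro: SUP_upper)
  ultimately have "0 < d \<and> (\<forall>j. d \<le> \<Sigma> j - \<Sigma> (j - 1) \<and> \<Sigma> j - \<Sigma> (j - 1) \<le> D)"
    using d(1) by (auto intro: less_imp_le)
  then show "\<exists>d>0. \<exists>D. \<forall>j. d \<le> \<Sigma> j - \<Sigma> (j - 1) \<and> \<Sigma> j - \<Sigma> (j - 1) \<le> D"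
    by blast
next
  assume "\<exists>d>0. \<exists>D. \<forall>j. d \<le> \<Sigma> j - \<Sigma> (j - 1) \<and> \<Sigma> j - \<Sigma> (j - 1) \<le> D"
  then obtain d D where dD: "0 < d" "\<And>j. d \<le> \<Sigma> j - \<Sigma> (j - 1)" "\<And>j. \<Sigma> j - \<Sigma> (j - 1) \<le> D"
    by blast
  have "ereal d \<le> (INF j. ereal (\<Sigma> j - \<Sigma> (j - 1)))"
    using dD by (intro INF_greatest) auto
  moreover have "(SUP j. ereal (\<Sigma> j - \<Sigma> (j - 1))) \<le> ereal D"
    using dD by (intro SUP_least) auto
  ultimately show "admissible \<Sigma>"
    using dD(1) unfolding admissible_def
    by (auto intro: less_le_trans[of 0 "ereal d"] le_less_trans[of _ "ereal D"])
qed

lemma admissible_grid: "0 < W \<Longrightarrow> admissible (grid W)"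
  unfolding admissible_iff grid_def
  by (intro exI[of _ "1 / W"] conjI exI[of _ "1 / W"]) (auto simp: field_simps)

text \<open>
  The gaps of an admissible sequence lie between two positive constants, so the weights do not affect
  convergence.
\<close>
lemma lp_norm_less_top_iff:
  assumes "admissible \<Sigma>"
  shows "lp_norm p \<Sigma> f < \<infinity> \<longleftrightarrow> (\<lambda>j. norm (f (\<Sigma> j)) powr p) summable_on UNIV"
proof -
  obtain d D where d: "0 < d" and dD: "\<And>j. d \<le> \<Sigma> j - \<Sigma> (j - 1)" "\<And>j. \<Sigma> j - \<Sigma> (j - 1) \<le> D"
    using assms unfolding admissible_iff by blast
  have gap: "0 \<le> \<Sigma> j - \<Sigma> (j - 1)" for j
    using d dD(1)[of j] by linarith
  have "lp_norm p \<Sigma> f < \<infinity> \<longleftrightarrow>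
      (\<lambda>j. norm (f (\<Sigma> j)) powr p * (\<Sigma> j - \<Sigma> (j - 1))) summable_on UNIV"
    unfolding lp_norm_def ennreal_powr_less_top_iff
    using gap by (intro infsum_ennreal_less_top_iff mult_nonneg_nonneg) auto
  also have "\<dots> \<longleftrightarrow> (\<lambda>j. norm (f (\<Sigma> j)) powr p) summable_on UNIV"
  proof
    assume *: "(\<lambda>j. norm (f (\<Sigma> j)) powr p * (\<Sigma> j - \<Sigma> (j - 1))) summable_on UNIV"
    have "(\<lambda>j. norm (f (\<Sigma> j)) powr p * (\<Sigma> j - \<Sigma> (j - 1)) * (1 / d)) summable_on UNIV"
      using * by (rule summable_on_cmult_left)
    then show "(\<lambda>j. norm (f (\<Sigma> j)) powr p) summable_on UNIV"
    proof (rule summable_on_comparison_test)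
      show "norm (f (\<Sigma> j)) powr p \<le> norm (f (\<Sigma> j)) powr p * (\<Sigma> j - \<Sigma> (j - 1)) * (1 / d)" for j
        using mult_left_mono[OF dD(1)[of j], of "norm (f (\<Sigma> j)) powr p"] d
        by (simp add: field_simps)
    qed auto
  next
    assume *: "(\<lambda>j. norm (f (\<Sigma> j)) powr p) summable_on UNIV"
    have "(\<lambda>j. norm (f (\<Sigma> j)) powr p * D) summable_on UNIV"
      using * by (rule summable_on_cmult_left)
    then show "(\<lambda>j. norm (f (\<Sigma> j)) powr p * (\<Sigma> j - \<Sigma> (j - 1))) summable_on UNIV"
      by (rule summable_on_comparison_test) (use gap dD in \<open>auto intro!: mult_left_mono\<close>)
  qed
  finally show ?thesis .
qed

lemma steps_between:
  fixes \<Sigma> :: "int \<Rightarrow> real"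
  assumes "\<And>j. d \<le> \<Sigma> j - \<Sigma> (j - 1)" "\<And>j. \<Sigma> j - \<Sigma> (j - 1) \<le> D"
  shows "real n * d \<le> \<Sigma> (j + int n) - \<Sigma> j \<and> \<Sigma> (j + int n) - \<Sigma> j \<le> real n * D"
proof (induction n)
  case (Suc n)
  then show ?case
    using assms(1)[of "j + int (Suc n)"] assms(2)[of "j + int (Suc n)"]
    by (simp add: algebra_simps)
qed simp

text \<open>
  The points \<open>y j\<close> themselves may be too close together to be admissible, or even out of order. But
  along a residue class of indices modulo a large \<open>N\<close> the nodes are more than \<open>R\<close> apart, so each of the
  \<open>N\<close> subsequences is admissible, and the \<open>N\<close> convergent sums add up.
\<close>
lemma Lambda_space_summable_near_nodes:
  fixes f :: "real \<Rightarrow> 'a::{real_normed_field, euclidean_space}"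
  assumes f: "f \<in> Lambda_space p" and adm: "admissible \<Sigma>"
    and y: "\<And>j. \<Sigma> j \<le> y j \<and> y j \<le> \<Sigma> j + R"
  shows "(\<lambda>j. norm (f (y j)) powr p) summable_on UNIV"
proof -
  obtain d D where d: "0 < d" and dD: "\<And>j. d \<le> \<Sigma> j - \<Sigma> (j - 1)" "\<And>j. \<Sigma> j - \<Sigma> (j - 1) \<le> D"
    using adm unfolding admissible_iff by blast
  have "R \<ge> 0"
    using y[of 0] by linarith
  (* N steps cover at least R + d, so that choosing points within R of the nodes
     still leaves gaps of at least d. *)
  define N where "N = nat \<lceil>R / d\<rceil> + 1"
  have N: "N > 0" "real N * d \<ge> R + d"
  proof -
    have "R / d + 1 \<le> real N"
      using \<open>R \<ge> 0\<close> d unfolding N_def by (simp add: real_nat_ceiling_ge)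
    then show "real N * d \<ge> R + d"
      using d by (simp add: field_simps)
  qed (simp add: N_def)
  have residue_class: "(\<lambda>j. norm (f (y j)) powr p) summable_on range (\<lambda>k. int N * k + i)" for i
  proof -
    let ?z = "\<lambda>k. y (int N * k + i)"
    have "admissible ?z"
      unfolding admissible_iff
    proof (rule exI[of _ d], rule conjI[OF d], rule exI[of _ "real N * D + R"], intro allI conjI)
      fix k
      have "real N * d \<le> \<Sigma> (int N * (k - 1) + i + int N) - \<Sigma> (int N * (k - 1) + i) \<and>
          \<Sigma> (int N * (k - 1) + i + int N) - \<Sigma> (int N * (k - 1) + i) \<le> real N * D"
        by (rule steps_between[of d \<Sigma> D, OF dD])
      moreover have "int N * (k - 1) + i + int N = int N * k + i"
        by (simp add: algebra_simps)
      ultimately show "d \<le> ?z k - ?z (k - 1)" "?z k - ?z (k - 1) \<le> real N * D + R"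
        using y[of "int N * k + i"] y[of "int N * (k - 1) + i"] N(2) by auto
    qed
    then have "lp_norm p ?z f < \<infinity>"
      using f by (auto simp: Lambda_space_def)
    then have "((\<lambda>j. norm (f (y j)) powr p) \<circ> (\<lambda>k. int N * k + i)) summable_on UNIV"
      unfolding lp_norm_less_top_iff[OF \<open>admissible ?z\<close>] by (simp add: o_def)
    moreover have "inj (\<lambda>k. int N * k + i)"
      using N(1) by (auto simp: inj_def)
    ultimately show ?thesis
      by (subst summable_on_reindex) auto
  qed
  have "(\<lambda>j. norm (f (y j)) powr p) summable_on (\<Union>i\<in>{0..<int N}. range (\<lambda>k. int N * k + i))"
  proof (rule summable_on_finite_union_disjoint)
    fix i i' assume "i \<in> {0..<int N}" "i' \<in> {0..<int N}" "i \<noteq> i'"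
    then show "range (\<lambda>k. int N * k + i) \<inter> range (\<lambda>k. int N * k + i') = {}"
      by (auto simp: set_eq_iff) (metis mod_mult_self4 mod_pos_pos_trivial add.commute)
  qed (use residue_class in auto)
  moreover have "(\<Union>i\<in>{0..<int N}. range (\<lambda>k. int N * k + i)) = UNIV"
  proof (intro UNIV_eq_I[symmetric] UN_I)
    fix j :: int
    show "j mod int N \<in> {0..<int N}"
      using N(1) by auto
    show "j \<in> range (\<lambda>k. int N * k + j mod int N)"
      by (rule range_eqI[of _ _ "j div int N"]) simp
  qed
  ultimately show ?thesis
    by simp
qed

text \<open>
  This is how membership in \<open>Lambda_space\<close> is transferred to averages of a function: an average over
  \<open>{x..x + R}\<close> is dominated by a value of the function in that interval.
\<close>
lemma Lambda_space_dominated: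
  fixes f h :: "real \<Rightarrow> 'a::{real_normed_field, euclidean_space}"
  assumes p: "0 \<le> p" and f: "f \<in> Lambda_space p" and h: "h \<in> borel_measurable lebesgue"
    and dom: "\<And>x. \<exists>y\<in>{x..x + R}. norm (h x) \<le> C * norm (f y)"
  shows "h \<in> Lambda_space p"
proof -
  obtain B where B: "\<And>x. norm (f x) \<le> B"
    using f by (auto simp: Lambda_space_def bounded_measurable_def bounded_iff)
  have "norm (h x) \<le> \<bar>C\<bar> * B" for x
  proof -
    obtain y where "norm (h x) \<le> C * norm (f y)"
      using dom by blast
    also have "\<dots> \<le> \<bar>C\<bar> * B"
      using B[of y] by (intro mult_mono) auto
    finally show ?thesis .
  qed
  then have "bounded (range h)"
    by (auto simp: bounded_iff)
  moreover have "lp_norm p \<Sigma> h < \<infinity>" if adm: "admissible \<Sigma>" for \<Sigma>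
  proof -
    from dom obtain y where y: "\<And>x. y x \<in> {x..x + R}" "\<And>x. norm (h x) \<le> C * norm (f (y x))"
      by metis
    have "(\<lambda>j. norm (f (y (\<Sigma> j))) powr p) summable_on UNIV"
      using y(1) by (intro Lambda_space_summable_near_nodes[OF f adm, of _ R]) auto
    then have "(\<lambda>j. \<bar>C\<bar> powr p * norm (f (y (\<Sigma> j))) powr p) summable_on UNIV"
      by (rule summable_on_cmult_right)
    then have "(\<lambda>j. norm (h (\<Sigma> j)) powr p) summable_on UNIV"
    proof (rule summable_on_comparison_test)
      show "norm (h (\<Sigma> j)) powr p \<le> \<bar>C\<bar> powr p * norm (f (y (\<Sigma> j))) powr p" for j
      proof -
        have "norm (h (\<Sigma> j)) \<le> \<bar>C\<bar> * norm (f (y (\<Sigma> j)))"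
          using y(2)[of "\<Sigma> j"] by (rule order.trans) (intro mult_right_mono, auto)
        then have "norm (h (\<Sigma> j)) powr p \<le> (\<bar>C\<bar> * norm (f (y (\<Sigma> j)))) powr p"
          using p by (intro powr_mono2) auto
        then show ?thesis
          by (simp add: powr_mult)
      qed
    qed auto
    then show ?thesis
      using lp_norm_less_top_iff[OF adm] by blast
  qed
  ultimately show ?thesis
    using h by (auto simp: Lambda_space_def bounded_measurable_def)
qed

text \<open>
  On each unit interval choose a point at which \<open>norm f\<close> is at least half its supremum there. These
  points lie near the integers, so the integral is bounded by a convergent sum.
\<close>
lemma Lambda_space_in_Lp:
  fixes f :: "real \<Rightarrow> 'a::{real_normed_field, euclidean_space}"
  assumes p: "1 \<le> p" and f: "f \<in> Lambda_space p"
  shows "in_Lp p f"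
proof -
  have meas [measurable]: "f \<in> borel_measurable lebesgue"
    using f by (auto simp: Lambda_space_def bounded_measurable_def)
  obtain B where B: "\<And>x. norm (f x) \<le> B"
    using f by (auto simp: Lambda_space_def bounded_measurable_def bounded_iff)
  have "\<exists>y\<in>{of_int j..of_int j + 1}. \<forall>x\<in>{of_int j..of_int j + 1}. norm (f x) \<le> 2 * norm (f y)" for j :: int
  proof -
    let ?I = "{real_of_int j..of_int j + 1}"
    define S where "S = (SUP x\<in>?I. norm (f x))"
    have bdd: "bdd_above ((\<lambda>x. norm (f x)) ` ?I)"
      using B by (intro bdd_aboveI[of _ B]) auto
    have S: "norm (f x) \<le> S" if "x \<in> ?I" for x
      unfolding S_def using that bdd by (rule cSUP_upper)
    show ?thesis
    proof (cases "S \<le> 0")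
      case True
      then have "norm (f x) \<le> 2 * norm (f (of_int j))" if "x \<in> ?I" for x
        using S[OF that] norm_ge_zero[of "f (of_int j)"] by linarith
      then show ?thesis
        by (intro bexI[of _ "of_int j"]) auto
    next
      case False
      then obtain y where "y \<in> ?I" "S / 2 < norm (f y)"
        using less_cSUP_iff[OF _ bdd, of "S / 2"] unfolding S_def by force
      then show ?thesis
        using S by (intro bexI[of _ y]) force+
    qed
  qed
  then obtain y where y: "\<And>j. y j \<in> {of_int j..of_int j + 1}"
    and y_max: "\<And>j x. x \<in> {of_int j..of_int j + 1} \<Longrightarrow> norm (f x) \<le> 2 * norm (f (y j))"
    by metis
  have "(\<lambda>j. norm (f (y j)) powr p) summable_on UNIV"
    using y admissible_grid[of 1]
    by (intro Lambda_space_summable_near_nodes[OF f, of "grid 1" _ 1]) (auto simp: grid_def)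
  then have sum: "(\<lambda>j. 2 powr p * norm (f (y j)) powr p) summable_on UNIV"
    by (rule summable_on_cmult_right)
  have "(\<integral>\<^sup>+ x. ennreal (norm (f x) powr p) \<partial>lebesgue)
      \<le> (\<integral>\<^sup>+ x. (\<integral>\<^sup>+ j. ennreal (2 powr p * norm (f (y j)) powr p) * indicator {real_of_int j..of_int j + 1} x
          \<partial>count_space UNIV) \<partial>lebesgue)"
  proof (rule nn_integral_mono)
    fix x :: real
    have x: "x \<in> {of_int \<lfloor>x\<rfloor>..of_int \<lfloor>x\<rfloor> + 1}"
      by auto
    have "norm (f x) powr p \<le> (2 * norm (f (y \<lfloor>x\<rfloor>))) powr p"
      using y_max[OF x] p by (intro powr_mono2) auto
    then have "ennreal (norm (f x) powr p)
        \<le> ennreal (2 powr p * norm (f (y \<lfloor>x\<rfloor>)) powr p) * indicator {of_int \<lfloor>x\<rfloor>..of_int \<lfloor>x\<rfloor> + 1} x"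
      using x by (simp add: powr_mult indicator_def)
    also have "\<dots> \<le> (\<integral>\<^sup>+ j. ennreal (2 powr p * norm (f (y j)) powr p) * indicator {real_of_int j..of_int j + 1} x
          \<partial>count_space UNIV)"
      by (rule nn_integral_ge_point[of "\<lfloor>x\<rfloor>" UNIV
            "\<lambda>j. ennreal (2 powr p * norm (f (y j)) powr p) * indicator {real_of_int j..of_int j + 1} x"]) simp
    finally show "ennreal (norm (f x) powr p) \<le> \<dots>" .
  qed
  also have "\<dots> = (\<integral>\<^sup>+ j. (\<integral>\<^sup>+ x. ennreal (2 powr p * norm (f (y j)) powr p) * indicator {real_of_int j..of_int j + 1} x
          \<partial>lebesgue) \<partial>count_space UNIV)"
  proof (rule nn_integral_count_space_nn_integral)
    fix j :: int
    have "{real_of_int j..of_int j + 1} \<in> sets lebesgue"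
      by (intro sets_completionI_sets) simp
    then show "(\<lambda>x. ennreal (2 powr p * norm (f (y j)) powr p) * indicator {real_of_int j..of_int j + 1} x)
        \<in> borel_measurable lebesgue"
      by (intro borel_measurable_times_ennreal borel_measurable_indicator) auto
  qed simp
  also have "\<dots> = (\<integral>\<^sup>+ j. ennreal (2 powr p * norm (f (y j)) powr p) \<partial>count_space UNIV)"
    unfolding nn_integral_completion by (intro nn_integral_cong) (simp add: nn_integral_cmult)
  also have "\<dots> < \<infinity>"
  proof -
    have "(\<lambda>j. norm (2 powr p * norm (f (y j)) powr p)) summable_on UNIV"
      using sum by (simp add: abs_mult)
    then have "integrable (count_space UNIV) (\<lambda>j. 2 powr p * norm (f (y j)) powr p)"
      using abs_summable_equivalent unfolding abs_summable_on_def by blast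
    then show ?thesis
      by (subst nn_integral_eq_integral) auto
  qed
  finally show ?thesis
    by (auto simp: in_Lp_def Lp_norm_def ennreal_powr_less_top_iff[simplified])
qed

section \<open>Window integrals of bounded Borel functions\<close>

definition bounded_borel :: "(real \<Rightarrow> 'a::{real_normed_field, euclidean_space}) set" where
  "bounded_borel = {h. h \<in> borel_measurable borel \<and> bounded (range h)}"

text \<open>
  The building block of Steklov averages. For \<open>c > 0\<close> a substitution turns it into \<open>1 / c\<close> times the
  integral of \<open>h\<close> over the window \<open>{x..x + c * d}\<close>, so that its derivative is the \<open>window_quotient\<close> below.
\<close>
definition window_integral ::
    "real \<Rightarrow> real \<Rightarrow> (real \<Rightarrow> 'a::{real_normed_field, euclidean_space}) \<Rightarrow> real \<Rightarrow> 'a" where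
  "window_integral d c h x = (LINT t:{0..d}|lebesgue. h (x + c * t))"

definition window_quotient ::
    "real \<Rightarrow> real \<Rightarrow> (real \<Rightarrow> 'a::{real_normed_field, euclidean_space}) \<Rightarrow> real \<Rightarrow> 'a" where
  "window_quotient d c h x = (1 / c) *\<^sub>R (h (x + c * d) - h x)"

lemma bounded_borel_bound:
  assumes "h \<in> bounded_borel"
  shows "\<exists>B\<ge>0. \<forall>x. norm (h x) \<le> B"
proof -
  obtain B where B: "\<And>x. norm (h x) \<le> B"
    using assms by (auto simp: bounded_borel_def bounded_iff)
  then have "0 \<le> B"
    using norm_ge_zero order.trans by blast
  with B show ?thesis
    by blast
qed

lemma bounded_borelI:
  "h \<in> borel_measurable borel \<Longrightarrow> (\<And>x. norm (h x) \<le> B) \<Longrightarrow> h \<in> bounded_borel"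
  by (auto simp: bounded_borel_def bounded_iff)

lemma bounded_borel_measurable: "h \<in> bounded_borel \<Longrightarrow> h \<in> borel_measurable borel"
  by (simp add: bounded_borel_def)

lemma borel_imp_lebesgue_measurable:
  "h \<in> borel_measurable borel \<Longrightarrow> h \<in> borel_measurable lebesgue"
  by (intro measurable_completion) simp

lemma set_integrable_affine:
  assumes "h \<in> bounded_borel"
  shows "set_integrable lebesgue {a..b} (\<lambda>t. h (x + c * t))"
proof -
  have [measurable]: "h \<in> borel_measurable borel"
    using assms by (rule bounded_borel_measurable)
  obtain B where "\<And>x. norm (h x) \<le> B"
    using bounded_borel_bound[OF assms] by blast
  then show ?thesis
    by (intro set_integrable_bounded_interval[where B = B] borel_imp_lebesgue_measurable) auto
qed

lemma window_integral_bounded_borel: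
  assumes "h \<in> bounded_borel" "0 \<le> d"
  shows "window_integral d c h \<in> bounded_borel"
proof -
  have [measurable]: "h \<in> borel_measurable borel"
    using assms(1) by (rule bounded_borel_measurable)
  obtain B where B: "0 \<le> B" "\<And>x. norm (h x) \<le> B"
    using bounded_borel_bound[OF assms(1)] by blast
  show ?thesis
  proof (rule bounded_borelI)
    have "case_prod (\<lambda>x t. h (x + c * t)) \<in> borel_measurable (borel \<Otimes>\<^sub>M borel)"
      by measurable
    then show "window_integral d c h \<in> borel_measurable borel"
      unfolding window_integral_def by (intro borel_measurable_parametric_set_integral) (simp add: borel_prod)
    show "norm (window_integral d c h x) \<le> d * B" for x
      unfolding window_integral_def using assms B by (intro norm_set_integral_interval_le) auto
  qed
qed

lemma window_quotient_bounded_borel: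
  assumes "h \<in> bounded_borel"
  shows "window_quotient d c h \<in> bounded_borel"
proof -
  have [measurable]: "h \<in> borel_measurable borel"
    using assms(1) by (rule bounded_borel_measurable)
  obtain B where B: "0 \<le> B" "\<And>x. norm (h x) \<le> B"
    using bounded_borel_bound[OF assms(1)] by blast
  show ?thesis
  proof (rule bounded_borelI)
    show "window_quotient d c h \<in> borel_measurable borel"
      unfolding window_quotient_def by measurable
    show "norm (window_quotient d c h x) \<le> \<bar>1 / c\<bar> * (B + B)" for x
    proof -
      have "norm (h (x + c * d) - h x) \<le> B + B"
        using norm_triangle_ineq4[of "h (x + c * d)" "h x"] B(2)[of "x + c * d"] B(2)[of x] by linarith
      then show ?thesis
        unfolding window_quotient_def norm_scaleR by (intro mult_left_mono) auto
    qed
  qed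
qed

lemma window_funpow_bounded_borel:
  assumes "h \<in> bounded_borel" "0 \<le> d"
  shows "(window_integral d c ^^ n) h \<in> bounded_borel"
    and "(window_quotient d c ^^ n) h \<in> bounded_borel"
  using assms by (induction n) (auto intro: window_integral_bounded_borel window_quotient_bounded_borel)

lemma Lp_norm_window_integral_le:
  assumes p: "1 \<le> p" and "0 < d" and h: "h \<in> bounded_borel"
  shows "Lp_norm p (window_integral d c h) \<le> ennreal d * Lp_norm p h"
proof -
  have m [measurable]: "h \<in> borel_measurable borel"
    using h by (rule bounded_borel_measurable)
  obtain B where B: "\<And>x. norm (h x) \<le> B"
    using bounded_borel_bound[OF h] by blast
  have "case_prod (\<lambda>x t. h (x + c * t)) \<in> borel_measurable (borel \<Otimes>\<^sub>M borel)"
    by measurable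
  then show ?thesis
    unfolding window_integral_def using B
    by (intro Lp_norm_set_integral_le[OF p \<open>0 < d\<close>, where B = B])
       (auto simp: borel_prod Lp_norm_translate borel_imp_lebesgue_measurable[OF m])
qed

lemma Lp_norm_window_integral_funpow_le:
  assumes p: "1 \<le> p" and d: "0 < d" and h: "h \<in> bounded_borel"
  shows "Lp_norm p ((window_integral d c ^^ n) h) \<le> ennreal (d ^ n) * Lp_norm p h"
proof (induction n)
  case 0
  then show ?case by simp
next
  case (Suc n)
  have "Lp_norm p ((window_integral d c ^^ Suc n) h) \<le> ennreal d * Lp_norm p ((window_integral d c ^^ n) h)"
    using d h by (auto intro!: Lp_norm_window_integral_le[OF p] window_funpow_bounded_borel)
  also have "\<dots> \<le> ennreal d * (ennreal (d ^ n) * Lp_norm p h)"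
    by (intro mult_left_mono Suc) simp
  finally show ?case
    using d by (simp add: ennreal_mult mult.assoc)
qed

text \<open>
  Both operators are linear and commute with translations. So all difference quotients that arise
  from repeated differentiation can be moved inside the remaining integrals.
\<close>
lemma window_integral_quotient_commute:
  assumes "h \<in> bounded_borel"
  shows "window_quotient d c (window_integral d c h) = window_integral d c (window_quotient d c h)"
proof
  fix x
  have "window_integral d c (window_quotient d c h) x
      = (LINT t:{0..d}|lebesgue. (1 / c) *\<^sub>R (h (x + c * d + c * t) - h (x + c * t)))"
    by (simp add: window_integral_def window_quotient_def add_ac)
  also have "\<dots> = (1 / c) *\<^sub>R (LINT t:{0..d}|lebesgue. h (x + c * d + c * t) - h (x + c * t))"
    by (rule set_integral_scaleR_right)
  also have "\<dots> = window_quotient d c (window_integral d c h) x"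
    using set_integrable_affine[OF assms]
    by (simp add: window_integral_def window_quotient_def set_integral_diff)
  finally show "window_quotient d c (window_integral d c h) x = window_integral d c (window_quotient d c h) x" ..
qed

lemma window_quotient_funpow_commute:
  assumes "h \<in> bounded_borel" "0 \<le> d"
  shows "window_quotient d c ((window_integral d c ^^ n) h) = (window_integral d c ^^ n) (window_quotient d c h)"
  using assms
  by (induction n) (auto simp: window_integral_quotient_commute window_funpow_bounded_borel)

section \<open>Derivatives of window integrals\<close>

text \<open>
  The primitive is the source of all regularity: it is Lipschitz because \<open>h\<close> is bounded,
  differentiable wherever \<open>h\<close> is continuous, and differentiable almost everywhere by the Lebesgue
  differentiation theorem. The mean values of \<open>h\<close> over \<open>{x..x + k}\<close> with \<open>k > 0\<close> give the right derivative,
  and those of the reflected function \<open>h (- u)\<close> give the left derivative.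
\<close>
lemma bounded_borel_primitive:
  fixes h :: "real \<Rightarrow> 'a::{real_normed_field, euclidean_space}"
  assumes h: "h \<in> bounded_borel"
  obtains P N B where "negligible N" "0 \<le> B"
    "\<And>a b. a \<le> b \<Longrightarrow> (LINT u:{a..b}|lebesgue. h u) = P b - P a"
    "\<And>x y. norm (P x - P y) \<le> B * \<bar>x - y\<bar>"
    "\<And>x. x \<notin> N \<Longrightarrow> (P has_vector_derivative h x) (at x)"
    "\<And>x. isCont h x \<Longrightarrow> (P has_vector_derivative h x) (at x)"
proof -
  obtain B where B: "0 \<le> B" "\<And>x. norm (h x) \<le> B"
    using bounded_borel_bound[OF h] by blast
  have sint: "set_integrable lebesgue {a..b} h" for a b
    using set_integrable_affine[OF h, of a b 0 1] by simp
  have int: "h integrable_on {a..b}" for a b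
    using set_lebesgue_integral_eq_integral(1)[OF sint] by simp
  define P where "P x = (if 0 \<le> x then integral {0..x} h else - integral {x..0} h)" for x
  have P: "integral {a..b} h = P b - P a" if "a \<le> b" for a b
  proof -
    consider "0 \<le> a" | "a < 0" "0 \<le> b" | "b < 0"
      by linarith
    then show ?thesis
    proof cases
      case 1
      then show ?thesis
        using Henstock_Kurzweil_Integration.integral_combine[OF 1 that int] 1 that by (simp add: P_def algebra_simps)
    next
      case 2
      then show ?thesis
        using Henstock_Kurzweil_Integration.integral_combine[OF less_imp_le[OF 2(1)] 2(2) int] 2 by (simp add: P_def algebra_simps)
    next
      case 3
      then show ?thesis
        using Henstock_Kurzweil_Integration.integral_combine[OF that less_imp_le[OF 3] int] that 3 by (simp add: P_def algebra_simps)
    qed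
  qed
  have lip: "norm (P y - P x) \<le> B * (y - x)" if "x \<le> y" for x y
    using has_integral_bound_real[OF B(1) finite.emptyI integrable_integral[OF int[of x y]]] B(2) that
    by (simp add: P)
  have cont: "(P has_vector_derivative h x) (at x)" if "isCont h x" for x
  proof -
    have "((\<lambda>u. integral {x - 1..u} h) has_vector_derivative h x) (at x within {x - 1..x + 1})"
      using integral_has_vector_derivative_continuous_at[OF int, of x "x - 1" "x + 1" "{}"] that
      by (simp add: continuous_at_imp_continuous_at_within)
    then have "((\<lambda>u. integral {x - 1..u} h) has_vector_derivative h x) (at x)"
      by (subst (asm) at_within_interior) auto
    then have "((\<lambda>u. P u - P (x - 1)) has_vector_derivative h x) (at x)"
      by (rule has_vector_derivative_transform_within_open[where S = "{x - 1<..}"]) (simp_all add: P)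
    then have "((\<lambda>u. (P u - P (x - 1)) + P (x - 1)) has_vector_derivative h x + 0) (at x)"
      by (intro has_vector_derivative_add has_vector_derivative_const)
    then show ?thesis
      by simp
  qed
  have int_box: "\<And>a b. h integrable_on cbox a b"
    using int by simp
  obtain N1 where N1: "negligible N1"
    and right: "\<And>x e. x \<notin> N1 \<Longrightarrow> 0 < e \<Longrightarrow> \<exists>d>0. \<forall>k. 0 < k \<and> k < d \<longrightarrow>
      norm (integral (cbox x (x + k *\<^sub>R One)) h /\<^sub>R k ^ DIM(real) - h x) < e"
    using integrable_ccontinuous_explicit[OF int_box] by metis
  have int': "(\<lambda>u. h (- u)) integrable_on cbox a b" for a b
    using int[of "- b" "- a"] Henstock_Kurzweil_Integration.integrable_reflect_real[of h "- a" "- b"] by simp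
  obtain N2 where N2: "negligible N2"
    and left: "\<And>x e. x \<notin> N2 \<Longrightarrow> 0 < e \<Longrightarrow> \<exists>d>0. \<forall>k. 0 < k \<and> k < d \<longrightarrow>
      norm (integral (cbox x (x + k *\<^sub>R One)) (\<lambda>u. h (- u)) /\<^sub>R k ^ DIM(real) - h (- x)) < e"
    using integrable_ccontinuous_explicit[OF int'] by metis
  define N where "N = N1 \<union> uminus ` N2"
  have "negligible N"
    unfolding N_def using N1 N2 by (intro negligible_Un negligible_differentiable_image_negligible) (auto intro!: differentiable_on_minus differentiable_on_id)
  moreover have "(P has_vector_derivative h x) (at x)" if "x \<notin> N" for x
    unfolding has_vector_derivative_def has_derivative_within_alt2
  proof (intro conjI allI impI)
    show "bounded_linear (\<lambda>k. k *\<^sub>R h x)"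
      by (rule bounded_linear_scaleR_left)
    fix e :: real assume "e > 0"
    have "x \<notin> N1" "- x \<notin> N2"
      using that by (force simp: N_def)+
    obtain d1 where d1: "d1 > 0" "\<And>k. 0 < k \<Longrightarrow> k < d1 \<Longrightarrow> norm ((P (x + k) - P x) /\<^sub>R k - h x) < e"
      using right[OF \<open>x \<notin> N1\<close> \<open>e > 0\<close>] by (auto simp: P)
    have refl: "integral {- x..k - x} (\<lambda>u. h (- u)) = P x - P (x - k)" if "0 < k" for k
    proof -
      have "integral {- x..- (x - k)} (\<lambda>u. h (- u)) = integral {x - k..x} h"
        by (rule Henstock_Kurzweil_Integration.integral_reflect_real)
      then show ?thesis
        using that by (simp add: P)
    qed
    obtain d2 where d2: "d2 > 0" "\<And>k. 0 < k \<Longrightarrow> k < d2 \<Longrightarrow> norm ((P x - P (x - k)) /\<^sub>R k - h x) < e"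
      using left[OF \<open>- x \<notin> N2\<close> \<open>e > 0\<close>] by (auto simp: refl)
    have scale: "norm (v - k *\<^sub>R w) \<le> e * k" if "0 < k" "norm (v /\<^sub>R k - w) < e" for k and v w :: 'a
    proof -
      have "v - k *\<^sub>R w = k *\<^sub>R (v /\<^sub>R k - w)"
        using that by (simp add: scaleR_diff_right)
      then have "norm (v - k *\<^sub>R w) = k * norm (v /\<^sub>R k - w)"
        using that by simp
      then show ?thesis
        using that by (simp add: mult.commute mult_left_mono)
    qed
    have "norm (P y - P x - (y - x) *\<^sub>R h x) \<le> e * norm (y - x)" if "dist y x < min d1 d2" for y
    proof (cases y x rule: linorder_cases)
      case less
      have "norm ((P x - P (x - (x - y))) /\<^sub>R (x - y) - h x) < e"
        using that less by (intro d2(2)) (auto simp: dist_real_def)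
      then have "norm (P x - P y - (x - y) *\<^sub>R h x) \<le> e * (x - y)"
        using less by (intro scale) auto
      moreover have "P y - P x - (y - x) *\<^sub>R h x = - (P x - P y - (x - y) *\<^sub>R h x)"
        by (simp add: algebra_simps)
      ultimately show ?thesis
        using less by (simp only: norm_minus_cancel) simp
    next
      case greater
      have "norm ((P (x + (y - x)) - P x) /\<^sub>R (y - x) - h x) < e"
        using that greater by (intro d1(2)) (auto simp: dist_real_def)
      then have "norm (P y - P x - (y - x) *\<^sub>R h x) \<le> e * (y - x)"
        using greater by (intro scale) auto
      then show ?thesis
        using greater by simp
    qed simp
    then show "\<forall>\<^sub>F y in at x. norm (P y - P x - (y - x) *\<^sub>R h x) \<le> e * norm (y - x)"
      using d1(1) d2(1) unfolding eventually_at by (intro exI[of _ "min d1 d2"]) auto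
  qed
  moreover have "(LINT u:{a..b}|lebesgue. h u) = P b - P a" if "a \<le> b" for a b
    using set_lebesgue_integral_eq_integral(2)[OF sint[of a b]] P[OF that] by simp
  moreover have "norm (P x - P y) \<le> B * \<bar>x - y\<bar>" for x y
    using lip[of x y] lip[of y x] by (cases "x \<le> y") (auto simp: norm_minus_commute)
  ultimately show thesis
    using that cont B(1) by metis
qed

lemma window_integral_eq_primitive:
  assumes "0 < c" "0 \<le> d" "h \<in> bounded_borel"
    and P: "\<And>a b. a \<le> b \<Longrightarrow> (LINT u:{a..b}|lebesgue. h u) = P b - P a"
  shows "window_integral d c h x = (1 / c) *\<^sub>R (P (x + c * d) - P x)"
proof -
  have [measurable]: "h \<in> borel_measurable borel"
    using assms(3) by (rule bounded_borel_measurable)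
  have "(LINT u:{x..x + c * d}|lebesgue. h u) = (LINT u|lborel. indicator {x..x + c * d} u *\<^sub>R h u)"
    unfolding set_lebesgue_integral_def by (intro integral_completion) measurable
  also have "\<dots> = \<bar>c\<bar> *\<^sub>R (LINT t|lborel. indicator {x..x + c * d} (x + c * t) *\<^sub>R h (x + c * t))"
    using assms by (intro lborel_integral_real_affine) auto
  also have "\<dots> = c *\<^sub>R (LINT t|lborel. indicator {0..d} t *\<^sub>R h (x + c * t))"
    using assms by (auto simp: indicator_def zero_le_mult_iff intro!: arg_cong2[where f = scaleR] Bochner_Integration.integral_cong)
  also have "(LINT t|lborel. indicator {0..d} t *\<^sub>R h (x + c * t)) = window_integral d c h x"
    unfolding window_integral_def set_lebesgue_integral_def by (intro integral_completion[symmetric]) measurable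
  finally have "c *\<^sub>R window_integral d c h x = P (x + c * d) - P x"
    using P[of x "x + c * d"] assms by simp
  then have "(1 / c) *\<^sub>R c *\<^sub>R window_integral d c h x = (1 / c) *\<^sub>R (P (x + c * d) - P x)"
    by simp
  then show ?thesis
    using assms by simp
qed

lemma window_integral_lipschitz:
  assumes "0 < c" "0 \<le> d" "h \<in> bounded_borel"
  obtains L where "\<And>x y. norm (window_integral d c h x - window_integral d c h y) \<le> L * \<bar>x - y\<bar>"
proof -
  obtain P N B where P: "\<And>a b. a \<le> b \<Longrightarrow> (LINT u:{a..b}|lebesgue. h u) = P b - P a"
    and lip: "\<And>x y. norm (P x - P y) \<le> B * \<bar>x - y\<bar>"
    using bounded_borel_primitive[OF assms(3)] by metis
  have "norm (window_integral d c h x - window_integral d c h y) \<le> (1 / c * (B + B)) * \<bar>x - y\<bar>" for x y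
  proof -
    have "window_integral d c h x - window_integral d c h y
        = (1 / c) *\<^sub>R ((P (x + c * d) - P (y + c * d)) - (P x - P y))"
      using window_integral_eq_primitive[OF assms P, of x] window_integral_eq_primitive[OF assms P, of y]
      by (simp add: scaleR_diff_right)
    then have "norm (window_integral d c h x - window_integral d c h y)
        = 1 / c * norm ((P (x + c * d) - P (y + c * d)) - (P x - P y))"
      using assms by simp
    also have "\<dots> \<le> 1 / c * (B * \<bar>x - y\<bar> + B * \<bar>x - y\<bar>)"
      using lip[of "x + c * d" "y + c * d"] lip[of x y] assms
      by (intro mult_left_mono order.trans[OF norm_triangle_ineq4]) auto
    finally show ?thesis
      by (simp add: algebra_simps)
  qed
  then show thesis
    by (rule that)
qed

lemma window_integral_isCont:
  assumes "0 < c" "0 \<le> d" "h \<in> bounded_borel"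
  shows "isCont (window_integral d c h) x"
proof -
  obtain L where L: "\<And>x y. norm (window_integral d c h x - window_integral d c h y) \<le> L * \<bar>x - y\<bar>"
    using window_integral_lipschitz[OF assms] by blast
  have "((\<lambda>y. window_integral d c h y - window_integral d c h x) \<longlongrightarrow> 0) (at x)"
  proof (rule Lim_null_comparison)
    show "\<forall>\<^sub>F y in at x. norm (window_integral d c h y - window_integral d c h x) \<le> L * \<bar>y - x\<bar>"
      using L by simp
    show "((\<lambda>y. L * \<bar>y - x\<bar>) \<longlongrightarrow> 0) (at x)"
      by (rule tendsto_eq_intros refl | simp)+
  qed
  then show ?thesis
    unfolding isCont_def by (simp add: LIM_zero_iff)
qed

text \<open>
  If \<open>h\<close> is itself a window integral, it is continuous and the derivative exists everywhere. For the
  innermost window integral of a Steklov average, \<open>h\<close> is only Borel and the derivative may fail to exist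
  on a null set.
\<close>
lemma window_integral_has_derivative:
  assumes "0 < c" "0 \<le> d" "h \<in> bounded_borel"
  shows "AE x in lebesgue. (window_integral d c h has_vector_derivative window_quotient d c h x) (at x)"
    and "(\<And>x. isCont h x) \<Longrightarrow> (window_integral d c h has_vector_derivative window_quotient d c h x) (at x)"
proof -
  obtain P N B where N: "negligible N"
    and P: "\<And>a b. a \<le> b \<Longrightarrow> (LINT u:{a..b}|lebesgue. h u) = P b - P a"
    and der: "\<And>x. x \<notin> N \<Longrightarrow> (P has_vector_derivative h x) (at x)"
    and cont: "\<And>x. isCont h x \<Longrightarrow> (P has_vector_derivative h x) (at x)"
    using bounded_borel_primitive[OF assms(3)] by metis
  have eq: "window_integral d c h = (\<lambda>x. (1 / c) *\<^sub>R (P (x + c * d) - P x))"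
    using window_integral_eq_primitive[OF assms P] by blast
  have *: "(window_integral d c h has_vector_derivative window_quotient d c h x) (at x)"
    if x: "(P has_vector_derivative h x) (at x)"
      and y: "(P has_vector_derivative h (x + c * d)) (at (x + c * d))" for x
  proof -
    have "((\<lambda>x. x + c * d) has_vector_derivative 1) (at x)"
      by (auto intro!: derivative_eq_intros)
    then have "((\<lambda>x. P (x + c * d)) has_vector_derivative h (x + c * d)) (at x)"
      using vector_diff_chain_at[of "\<lambda>x. x + c * d" 1 x P "h (x + c * d)"] y by (simp add: o_def)
    then show ?thesis
      unfolding eq window_quotient_def
      using has_vector_derivative_diff[OF _ x] bounded_linear.has_vector_derivative[OF bounded_linear_scaleR_right]
      by blast
  qed
  show "(window_integral d c h has_vector_derivative window_quotient d c h x) (at x)" if "\<And>x. isCont h x"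
    using that cont * by blast
  have "negligible (N \<union> (+) (- (c * d)) ` N)"
    using N by (intro negligible_Un negligible_translation)
  then have "AE x in lebesgue. x \<notin> N \<union> (+) (- (c * d)) ` N"
    by (intro AE_not_in) (simp add: negligible_iff_null_sets)
  then show "AE x in lebesgue. (window_integral d c h has_vector_derivative window_quotient d c h x) (at x)"
  proof eventually_elim
    case (elim x)
    then have "x \<notin> N" "x + c * d \<notin> N"
      by (auto simp: image_iff)
    then show ?case
      using der * by blast
  qed
qed

section \<open>Finite differences and the modulus of smoothness\<close>

lemma difference_0: "difference 0 h f = f"
  by (simp add: difference_def fun_eq_iff)

text \<open>
  Pascal's rule. All properties of higher differences are derived from this recursion.
\<close>
lemma difference_Suc: "difference (Suc n) h f x = difference n h f (x + h) - difference n h f x"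
proof -
  let ?a = "\<lambda>k. f (x + of_nat k * h)"
  have flip: "of_nat (n choose Suc k) * (-1) ^ (n - k) * v = - (of_nat (n choose Suc k) * (-1) ^ (n - Suc k) * v)"
    if "k \<le> n" for k and v :: 'a
  proof (cases "k = n")
    case False
    then have "n - k = Suc (n - Suc k)"
      using that by auto
    then show ?thesis
      by simp
  qed simp
  have "difference n h f x = (\<Sum>k=0..Suc n. of_nat (n choose k) * (-1) ^ (n - k) * ?a k)"
    by (simp add: difference_def)
  also have "\<dots> = (-1) ^ n * ?a 0 + (\<Sum>k=0..n. of_nat (n choose Suc k) * (-1) ^ (n - Suc k) * ?a (Suc k))"
    by (subst sum.atLeast0_atMost_Suc_shift) simp
  finally have low: "- difference n h f x
      = (-1) ^ Suc n * ?a 0 + (\<Sum>k=0..n. of_nat (n choose Suc k) * (-1) ^ (n - k) * ?a (Suc k))"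
    by (simp add: flip flip: sum_negf)
  have "difference (Suc n) h f x
      = (-1) ^ Suc n * ?a 0 + (\<Sum>k=0..n. of_nat (Suc n choose Suc k) * (-1) ^ (n - k) * ?a (Suc k))"
    unfolding difference_def by (subst sum.atLeast0_atMost_Suc_shift) simp
  also have "\<dots> = (\<Sum>k=0..n. of_nat (n choose k) * (-1) ^ (n - k) * ?a (Suc k)) +
      ((-1) ^ Suc n * ?a 0 + (\<Sum>k=0..n. of_nat (n choose Suc k) * (-1) ^ (n - k) * ?a (Suc k)))"
    by (simp add: distrib_right sum.distrib)
  also have "(\<Sum>k=0..n. of_nat (n choose k) * (-1) ^ (n - k) * ?a (Suc k)) = difference n h f (x + h)"
    by (simp add: difference_def algebra_simps)
  finally show ?thesis
    unfolding low[symmetric] by simp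
qed

text \<open>
  This covers the boundary case of step \<open>0\<close>, which the modulus of smoothness excludes but which
  occurs in the averages below.
\<close>
lemma difference_zero_step:
  assumes "0 < n"
  shows "difference n 0 f x = 0"
  using assms by (cases n) (auto simp: difference_Suc)

lemma window_quotient_funpow_eq_difference:
  "(window_quotient d c ^^ n) h x = (1 / c ^ n) *\<^sub>R difference n (c * d) h x"
proof (induction n arbitrary: x)
  case 0
  then show ?case
    by (simp add: difference_0)
next
  case (Suc n)
  then show ?case
    by (simp add: window_quotient_def difference_Suc scaleR_diff_right)
qed

lemma difference_measurable:
  assumes "f \<in> borel_measurable lebesgue"
  shows "difference n h f \<in> borel_measurable lebesgue"
proof (induction n)
  case 0
  then show ?case
    using assms by (simp add: difference_0)
next
  case (Suc n)
  have "(\<lambda>x. difference n h f (h + 1 * x)) \<in> borel_measurable lebesgue"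
    using Suc by (intro measurable_real_affine_lebesgue) auto
  then have "(\<lambda>x. difference n h f (x + h) - difference n h f x) \<in> borel_measurable lebesgue"
    using Suc by (intro borel_measurable_diff) (auto simp: add.commute)
  then show ?case
    by (simp add: difference_Suc[abs_def])
qed

lemma Lp_norm_difference_le:
  assumes "1 \<le> p" "f \<in> borel_measurable lebesgue"
  shows "Lp_norm p (difference (n + k) h f) \<le> 2 ^ k * Lp_norm p (difference n h f)"
proof (induction k)
  case 0
  then show ?case by simp
next
  case (Suc k)
  let ?D = "difference (n + k) h f"
  have "Lp_norm p (difference (n + Suc k) h f) = Lp_norm p (\<lambda>x. ?D (x + h) - ?D x)"
    by (simp add: difference_Suc[abs_def])
  also have "\<dots> \<le> Lp_norm p (\<lambda>x. ?D (x + h)) + Lp_norm p ?D"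
    by (rule Lp_norm_diff[OF assms(1)])
  also have "\<dots> = 2 * Lp_norm p ?D"
    by (simp add: Lp_norm_translate difference_measurable assms mult_2)
  also have "\<dots> \<le> 2 * (2 ^ k * Lp_norm p (difference n h f))"
    by (intro mult_left_mono Suc) auto
  finally show ?case
    by (simp add: mult.assoc)
qed

lemma modulus_add_le:
  fixes f :: "real \<Rightarrow> 'a::{real_normed_field, euclidean_space}"
  assumes "1 \<le> p" "f \<in> borel_measurable lebesgue"
  shows "modulus (n + k) p f \<delta> \<le> 2 ^ k * modulus n p f \<delta>"
  unfolding modulus_def
proof (rule SUP_least)
  fix h assume h: "h \<in> {0<..\<delta>}"
  have "Lp_norm p (difference (n + k) h f) \<le> 2 ^ k * Lp_norm p (difference n h f)"
    by (rule Lp_norm_difference_le[OF assms])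
  also have "\<dots> \<le> 2 ^ k * (SUP h\<in>{0<..\<delta>}. Lp_norm p (difference n h f))"
    by (intro mult_left_mono SUP_upper h) simp
  finally show "Lp_norm p (difference (n + k) h f) \<le> 2 ^ k * (SUP h\<in>{0<..\<delta>}. Lp_norm p (difference n h f))" .
qed

lemma modulus_less_top:
  fixes f :: "real \<Rightarrow> 'a::{real_normed_field, euclidean_space}"
  assumes p: "1 \<le> p" and f: "in_Lp p f"
  shows "modulus s p f \<delta> < \<infinity>"
proof -
  have "modulus s p f \<delta> \<le> 2 ^ s * modulus 0 p f \<delta>"
    using modulus_add_le[OF p in_Lp_measurable[OF f], of 0 s] by simp
  also have "\<dots> \<le> 2 ^ s * Lp_norm p f"
    unfolding modulus_def difference_0 by (intro mult_left_mono SUP_least) auto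
  also have "\<dots> < \<infinity>"
    using f by (simp add: in_Lp_def ennreal_mult_less_top power_less_top_ennreal)
  finally show ?thesis .
qed

section \<open>Borel representatives\<close>

text \<open>
  An exceptional set is contained in a Borel null set, whose affine preimages are null sets as well.
\<close>
lemma AE_lebesgue_affine:
  assumes "AE x in lebesgue. P x" "c \<noteq> 0"
  shows "AE x in lebesgue. P (t + c * x :: real)"
proof -
  obtain N where N: "{x. \<not> P x} \<subseteq> N" "N \<in> null_sets lborel"
    using assms(1) unfolding AE_completion_iff by (auto elim!: AE_E simp: null_setsI)
  then have [measurable]: "N \<in> sets borel"
    by auto
  have "AE x in lborel. t + c * x \<notin> N"
    using AE_not_in[OF N(2)] assms(2) by (intro AE_borel_affine[where P = "\<lambda>x. x \<notin> N"]) auto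
  then show ?thesis
    unfolding AE_completion_iff by eventually_elim (use N(1) in auto)
qed

lemma modulus_cong_AE:
  assumes "f \<in> borel_measurable lebesgue" "g \<in> borel_measurable lebesgue" "AE x in lebesgue. f x = g x"
  shows "modulus s p f \<delta> = modulus s p g \<delta>"
proof -
  have "Lp_norm p (difference s h f) = Lp_norm p (difference s h g)" for h
  proof (intro Lp_norm_cong_AE difference_measurable assms)
    have "AE x in lebesgue. \<forall>k\<in>{0..s}. f (of_nat k * h + 1 * x) = g (of_nat k * h + 1 * x)"
      by (intro AE_finite_allI AE_lebesgue_affine[OF assms(3)]) auto
    then show "AE x in lebesgue. difference s h f x = difference s h g x"
      by eventually_elim (auto simp: difference_def add.commute intro!: sum.cong)
  qed
  then show ?thesis
    by (simp add: modulus_def)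
qed

text \<open>
  A representative exists componentwise; cutting it off where it exceeds the bound of \<open>f\<close> changes it
  on a null set only.
\<close>
lemma bounded_measurable_ex_bounded_borel:
  fixes f :: "real \<Rightarrow> 'a::{real_normed_field, euclidean_space}"
  assumes "f \<in> bounded_measurable"
  obtains g where "g \<in> bounded_borel" "AE x in lebesgue. f x = g x"
proof -
  have meas: "f \<in> borel_measurable lebesgue"
    using assms by (simp add: bounded_measurable_def)
  obtain B where B: "\<And>x. norm (f x) \<le> B"
    using assms by (auto simp: bounded_measurable_def bounded_iff)
  have "\<exists>g'\<in>borel_measurable lborel. AE x in lborel. f x \<bullet> i = g' x" for i
    using meas by (intro completion_ex_borel_measurable_real) auto
  then obtain G where G [measurable]: "\<And>i. G i \<in> borel_measurable lborel"
    and AE: "\<And>i. AE x in lborel. f x \<bullet> i = G i x"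
    by metis
  define g where "g x = (\<Sum>i\<in>Basis. G i x *\<^sub>R i)" for x :: real
  have g [measurable]: "g \<in> borel_measurable borel"
    unfolding g_def using G by simp
  have "AE x in lborel. \<forall>i\<in>Basis. f x \<bullet> i = G i x"
    using AE by (intro AE_finite_allI) auto
  then have eq: "AE x in lborel. f x = g x"
  proof eventually_elim
    case (elim x)
    then have "g x = (\<Sum>i\<in>Basis. (f x \<bullet> i) *\<^sub>R i)"
      by (simp add: g_def)
    then show ?case
      by (simp add: euclidean_representation)
  qed
  show thesis
  proof (rule that)
    show "(\<lambda>x. if norm (g x) \<le> B then g x else 0) \<in> bounded_borel"
      by (rule bounded_borelI[where B = "\<bar>B\<bar>"]) (measurable, auto)
    show "AE x in lebesgue. f x = (if norm (g x) \<le> B then g x else 0)"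
      unfolding AE_completion_iff using eq
    proof eventually_elim
      case (elim x)
      then show ?case
        using B[of x] by simp
    qed
  qed
qed

section \<open>Iterated integrals\<close>

text \<open>
  A single integration already suffices to remove the dependence on null sets, because for \<open>c k \<noteq> 0\<close> the
  innermost integral runs over a nondegenerate affine image of \<open>{0..d}\<close>. The base points \<open>y k\<close> are
  arbitrary since the outer integrations shift them, by amounts that depend on \<open>k\<close>.
\<close>
lemma iterated_integral_cong_AE:
  fixes f g :: "real \<Rightarrow> 'a::{real_normed_field, euclidean_space}"
  assumes meas: "f \<in> borel_measurable lebesgue" "g \<in> borel_measurable lebesgue"
    and eq: "AE x in lebesgue. f x = g x" and c: "\<And>k. k \<in> K \<Longrightarrow> c k \<noteq> 0" and K: "finite K"
  shows "iterated_integral d (Suc n) (\<lambda>ts. \<Sum>k\<in>K. a k * f (y k + c k * sum_list ts))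
       = iterated_integral d (Suc n) (\<lambda>ts. \<Sum>k\<in>K. a k * g (y k + c k * sum_list ts))"
proof (induction n arbitrary: y)
  case 0
  have m: "(\<lambda>t. indicator {0..d} t *\<^sub>R (\<Sum>k\<in>K. a k * F (y k + c k * t))) \<in> borel_measurable lebesgue"
    if "F \<in> borel_measurable lebesgue" for F
  proof (intro borel_measurable_scaleR borel_measurable_sum borel_measurable_times borel_measurable_const)
    show "(\<lambda>t. F (y k + c k * t)) \<in> borel_measurable lebesgue" if "k \<in> K" for k
      using \<open>F \<in> _\<close> c[OF that] by (intro measurable_real_affine_lebesgue)
  qed (auto intro: borel_measurable_indicator)
  have "AE t in lebesgue. \<forall>k\<in>K. f (y k + c k * t) = g (y k + c k * t)"
    using c K by (intro AE_finite_allI AE_lebesgue_affine[OF eq]) auto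
  then have "(LINT t:{0..d}|lebesgue. \<Sum>k\<in>K. a k * f (y k + c k * t))
      = (LINT t:{0..d}|lebesgue. \<Sum>k\<in>K. a k * g (y k + c k * t))"
    unfolding set_lebesgue_integral_def
    by (intro integral_cong_AE m meas) (auto elim!: eventually_mono intro!: sum.cong)
  then show ?case
    by simp
next
  case (Suc n)
  have step: "iterated_integral d (Suc (Suc n)) (\<lambda>ts. \<Sum>k\<in>K. a k * F (y k + c k * sum_list ts))
      = (LINT t:{0..d}|lebesgue.
          iterated_integral d (Suc n) (\<lambda>ts. \<Sum>k\<in>K. a k * F ((y k + c k * t) + c k * sum_list ts)))"
    for F :: "real \<Rightarrow> 'a"
    unfolding iterated_integral.simps(2)[of d "Suc n"] by (simp only: sum_list.Cons distrib_left add.assoc)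
  show ?case
    unfolding step Suc ..
qed

text \<open>
  A vanishing \<open>c k\<close> accounts for the term of a finite difference that stays at the base point.
\<close>
lemma iterated_integral_eq_window_integral:
  fixes f :: "real \<Rightarrow> 'a::{real_normed_field, euclidean_space}"
  assumes f: "f \<in> bounded_borel" and d: "0 \<le> d" and K: "finite K"
  shows "iterated_integral d n (\<lambda>ts. \<Sum>k\<in>K. a k * f (y k + c k * sum_list ts))
       = (\<Sum>k\<in>K. a k * (window_integral d (c k) ^^ n) f (y k))"
proof (induction n arbitrary: y)
  case 0
  then show ?case by simp
next
  case (Suc n)
  have int: "integrable lebesgue (\<lambda>t. indicator {0..d} t *\<^sub>R (a k * (window_integral d (c k) ^^ n) f (y k + c k * t)))" for k
  proof -
    have "set_integrable lebesgue {0..d} (\<lambda>t. (window_integral d (c k) ^^ n) f (y k + c k * t))"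
      by (intro set_integrable_affine window_funpow_bounded_borel f d)
    then have "set_integrable lebesgue {0..d} (\<lambda>t. a k * (window_integral d (c k) ^^ n) f (y k + c k * t))"
      by (rule set_integrable_mult_right)
    then show ?thesis
      by (simp add: set_integrable_def)
  qed
  have "iterated_integral d (Suc n) (\<lambda>ts. \<Sum>k\<in>K. a k * f (y k + c k * sum_list ts))
      = (LINT t:{0..d}|lebesgue.
          iterated_integral d n (\<lambda>ts. \<Sum>k\<in>K. a k * f ((y k + c k * t) + c k * sum_list ts)))"
    by (simp add: distrib_left add.assoc)
  also have "\<dots> = (LINT t:{0..d}|lebesgue. \<Sum>k\<in>K. a k * (window_integral d (c k) ^^ n) f (y k + c k * t))"
    unfolding Suc ..
  also have "\<dots> = (\<Sum>k\<in>K. LINT t:{0..d}|lebesgue. a k * (window_integral d (c k) ^^ n) f (y k + c k * t))"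
    unfolding set_lebesgue_integral_def scaleR_sum_right by (intro Bochner_Integration.integral_sum int)
  also have "\<dots> = (\<Sum>k\<in>K. a k * (window_integral d (c k) ^^ Suc n) f (y k))"
    by (simp add: window_integral_def)
  finally show ?case .
qed

lemma norm_iterated_integral_le:
  assumes "0 \<le> d" "0 \<le> B" "\<And>ts. set ts \<subseteq> {0..d} \<Longrightarrow> length ts = n \<Longrightarrow> norm (F ts) \<le> B"
  shows "norm (iterated_integral d n F) \<le> d ^ n * B"
  using assms(3)
proof (induction n arbitrary: F)
  case 0
  then show ?case by simp
next
  case (Suc n)
  have "norm (iterated_integral d (Suc n) F) \<le> d * (d ^ n * B)"
    unfolding iterated_integral.simps
  proof (rule norm_set_integral_interval_le)
    show "norm (iterated_integral d n (\<lambda>ts. F (t # ts))) \<le> d ^ n * B" if "t \<in> {0..d}" for t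
      using that by (intro Suc.IH Suc.prems) auto
  qed (use assms in auto)
  then show ?case
    by (simp add: mult.assoc)
qed

text \<open>
  Joint measurability in \<open>x\<close> and in an additional shift \<open>u\<close> is what the next integration requires, since
  its variable enters as a shift.
\<close>
lemma iterated_integral_shift_measurable:
  fixes K :: "real \<Rightarrow> real \<Rightarrow> 'a::{real_normed_field, euclidean_space}"
  assumes d: "0 \<le> d" and K: "case_prod K \<in> borel_measurable borel" and B: "0 \<le> B" "\<And>x u. norm (K x u) \<le> B"
  shows "(\<lambda>(x, u). iterated_integral d n (\<lambda>ts. K x (u + sum_list ts))) \<in> borel_measurable borel"
proof (induction n)
  case 0
  then show ?case
    using K by simp
next
  case (Suc n)
  let ?J = "\<lambda>x u. iterated_integral d n (\<lambda>ts. K x (u + sum_list ts))"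
  have J: "case_prod ?J \<in> borel_measurable borel"
    using Suc by simp
  have m: "(\<lambda>q :: (real \<times> real) \<times> real. (fst (fst q), snd (fst q) + snd q)) \<in> borel \<rightarrow>\<^sub>M borel"
    by (intro borel_measurable_continuous_onI continuous_intros)
  have "(\<lambda>(z, t). ?J (fst z) (snd z + t)) \<in> borel_measurable borel"
    using measurable_compose[OF m J] by (simp add: split_beta')
  then have "(\<lambda>z. LINT t:{0..d}|lebesgue. ?J (fst z) (snd z + t)) \<in> borel_measurable borel"
    by (rule borel_measurable_parametric_set_integral)
  then show ?case
    by (simp add: split_beta' add.assoc)
qed

text \<open>
  Minkowski's integral inequality, once per integration. A shift \<open>u\<close> is carried along because the
  outer variables add up in the second argument of \<open>K\<close>.
\<close>
lemma Lp_norm_iterated_integral_le: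
  fixes K :: "real \<Rightarrow> real \<Rightarrow> 'a::{real_normed_field, euclidean_space}"
  assumes p: "1 \<le> p" and d: "0 < d"
    and K: "case_prod K \<in> borel_measurable borel" and B: "0 \<le> B" "\<And>x u. norm (K x u) \<le> B"
    and M: "\<And>v. u \<le> v \<Longrightarrow> v \<le> u + real n * d \<Longrightarrow> Lp_norm p (\<lambda>x. K x v) \<le> M"
  shows "Lp_norm p (\<lambda>x. iterated_integral d n (\<lambda>ts. K x (u + sum_list ts))) \<le> ennreal (d ^ n) * M"
  using M
proof (induction n arbitrary: u)
  case 0
  then show ?case by simp
next
  case (Suc n)
  let ?J = "\<lambda>x u. iterated_integral d n (\<lambda>ts. K x (u + sum_list ts))"
  have m: "(\<lambda>z :: real \<times> real. (fst z, u + snd z)) \<in> borel \<rightarrow>\<^sub>M borel"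
    by (intro borel_measurable_continuous_onI continuous_intros)
  have meas: "case_prod (\<lambda>x t. ?J x (u + t)) \<in> borel_measurable borel"
    using measurable_compose[OF m iterated_integral_shift_measurable[OF less_imp_le[OF d] K B]]
    by (simp add: split_beta')
  have "Lp_norm p (\<lambda>x. LINT t:{0..d}|lebesgue. ?J x (u + t)) \<le> ennreal d * (ennreal (d ^ n) * M)"
  proof (rule Lp_norm_set_integral_le[OF p d meas])
    show "norm (?J x (u + t)) \<le> d ^ n * B" for x t
      using d B by (intro norm_iterated_integral_le) auto
    show "Lp_norm p (\<lambda>x. ?J x (u + t)) \<le> ennreal (d ^ n) * M" if "t \<in> {0..d}" for t
    proof (rule Suc.IH)
      fix v assume "u + t \<le> v" "v \<le> u + t + real n * d"
      then show "Lp_norm p (\<lambda>x. K x v) \<le> M"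
        using that by (intro Suc.prems) (auto simp: algebra_simps)
    qed
  qed
  then show ?case
    using d by (simp add: add.assoc ennreal_mult mult.assoc)
qed

section \<open>Steklov averages as approximants\<close>

abbreviation steklov_coeff :: "nat \<Rightarrow> nat \<Rightarrow> 'a::{real_normed_field, euclidean_space}" where
  "steklov_coeff r m \<equiv> (-1) ^ (r - m + 1) * of_nat (r choose m)"

lemma abs_powi_minus: "0 < d \<Longrightarrow> \<bar>(- d :: real) powi (- int r)\<bar> = 1 / d ^ r"
  by (simp add: power_int_minus abs_mult power_abs inverse_eq_divide)

lemma steklov_eq_window_integral:
  fixes g :: "real \<Rightarrow> 'a::{real_normed_field, euclidean_space}"
  assumes "g \<in> bounded_borel" "0 < d"
  shows "steklov r d g x = ((- d) powi (- int r)) *\<^sub>R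
    (\<Sum>m=1..r. steklov_coeff r m * (window_integral d (real m / real r) ^^ r) g x)"
  unfolding steklov_def using assms by (subst iterated_integral_eq_window_integral) auto

lemma steklov_cong_AE:
  fixes f g :: "real \<Rightarrow> 'a::{real_normed_field, euclidean_space}"
  assumes "f \<in> borel_measurable lebesgue" "g \<in> borel_measurable lebesgue"
    and "AE x in lebesgue. f x = g x" "0 < r"
  shows "steklov r d f = steklov r d g"
proof
  fix x
  obtain n where r: "r = Suc n"
    using \<open>0 < r\<close> gr0_implies_Suc by blast
  show "steklov r d f x = steklov r d g x"
    unfolding steklov_def unfolding r
    by (subst iterated_integral_cong_AE[OF assms(1-3)]) auto
qed

text \<open>
  The points at which \<open>f\<close> is evaluated lie in \<open>{x..x + r * d}\<close>, and the binomial coefficients add up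
  to at most \<open>2 ^ r\<close>.
\<close>
lemma steklov_dominated:
  fixes f :: "real \<Rightarrow> 'a::{real_normed_field, euclidean_space}"
  assumes d: "0 < d" and B: "\<And>y. y \<in> {x..x + real r * d} \<Longrightarrow> norm (f y) \<le> B"
  shows "norm (steklov r d f x) \<le> 2 ^ r * B"
proof -
  have "norm (f x) \<le> B"
    using d by (intro B) auto
  then have "0 \<le> B"
    using norm_ge_zero order.trans by blast
  have "norm (iterated_integral d r (\<lambda>ts. \<Sum>m=1..r. steklov_coeff r m *
      f (x + real m / real r * sum_list ts))) \<le> d ^ r * (2 ^ r * B)"
  proof (rule norm_iterated_integral_le)
    fix ts :: "real list" assume ts: "set ts \<subseteq> {0..d}" "length ts = r"
    have sum: "0 \<le> sum_list ts" "sum_list ts \<le> real r * d"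
      using ts(1) unfolding ts(2)[symmetric] by (induction ts) (auto simp: algebra_simps)
    have "norm (\<Sum>m=1..r. steklov_coeff r m * f (x + real m / real r * sum_list ts))
        \<le> (\<Sum>m=1..r. real (r choose m) * B)"
    proof (intro sum_norm_le)
      fix m assume "m \<in> {1..r}"
      then have "0 \<le> real m / real r" "real m / real r \<le> 1"
        by (auto simp: field_simps)
      then have "0 \<le> real m / real r * sum_list ts" "real m / real r * sum_list ts \<le> 1 * (real r * d)"
        using sum by (intro mult_nonneg_nonneg mult_mono; simp)+
      then show "norm (steklov_coeff r m * f (x + real m / real r * sum_list ts)) \<le> real (r choose m) * B"
        unfolding norm_mult norm_power by (auto intro!: mult_left_mono B)
    qed
    also have "\<dots> = real (\<Sum>m=1..r. r choose m) * B"
      by (simp add: sum_distrib_right)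
    also have "(\<Sum>m=1..r. r choose m) \<le> (\<Sum>m\<le>r. r choose m)"
      by (intro sum_mono2) auto
    then have "real (\<Sum>m=1..r. r choose m) * B \<le> 2 ^ r * B"
      using \<open>0 \<le> B\<close> unfolding choose_row_sum by (intro mult_right_mono) (metis of_nat_le_iff of_nat_numeral of_nat_power)+
    finally show "norm (\<Sum>m=1..r. steklov_coeff r m * f (x + real m / real r * sum_list ts)) \<le> 2 ^ r * B" .
  qed (use d \<open>0 \<le> B\<close> in auto)
  then have "norm (steklov r d f x) \<le> 1 / d ^ r * (d ^ r * (2 ^ r * B))"
    unfolding steklov_def norm_scaleR abs_powi_minus[OF d] using d by (intro mult_left_mono) auto
  then show ?thesis
    using d by simp
qed

text \<open>
  The supremum of \<open>norm f\<close> over the interval need not be attained; the factor \<open>2\<close> replaces it by a value.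
\<close>
lemma ex_near_norm_le:
  fixes f :: "real \<Rightarrow> 'a::real_normed_vector"
  assumes "0 \<le> R" "0 < C" and le: "\<And>B. (\<And>y. y \<in> {x..x + R} \<Longrightarrow> norm (f y) \<le> B) \<Longrightarrow> v \<le> C * B"
  shows "\<exists>y\<in>{x..x + R}. v \<le> 2 * C * norm (f y)"
proof (rule ccontr)
  assume "\<not> ?thesis"
  then have small: "norm (f y) < v / (2 * C)" if "y \<in> {x..x + R}" for y
    using that \<open>0 < C\<close> by (auto simp: field_simps not_le)
  then have "v \<le> C * (v / (2 * C))"
    by (intro le) (auto intro: less_imp_le)
  moreover have "0 < v / (2 * C)"
    using small[of x] assms(1) le_less_trans[OF norm_ge_zero] by auto
  ultimately show False
    using \<open>0 < C\<close> by (simp add: zero_less_divide_iff)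
qed

lemma steklov_in_Lambda_space:
  fixes f :: "real \<Rightarrow> 'a::{real_normed_field, euclidean_space}"
  assumes p: "1 \<le> p" and f: "f \<in> Lambda_space p" and d: "0 < d"
    and meas: "steklov r d f \<in> borel_measurable lebesgue"
  shows "steklov r d f \<in> Lambda_space p"
    and "(\<lambda>x. steklov r d f x - f x) \<in> Lambda_space p"
proof -
  show "steklov r d f \<in> Lambda_space p"
  proof (rule Lambda_space_dominated[OF _ f meas])
    show "\<exists>y\<in>{x..x + real r * d}. norm (steklov r d f x) \<le> 2 * 2 ^ r * norm (f y)" for x
      using d by (intro ex_near_norm_le) (auto intro: steklov_dominated)
  qed (use p in auto)
  have "f \<in> borel_measurable lebesgue"
    using f by (auto simp: Lambda_space_def bounded_measurable_def)
  then have diff: "(\<lambda>x. steklov r d f x - f x) \<in> borel_measurable lebesgue"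
    using meas by (intro borel_measurable_diff)
  show "(\<lambda>x. steklov r d f x - f x) \<in> Lambda_space p"
  proof (rule Lambda_space_dominated[OF _ f diff])
    show "\<exists>y\<in>{x..x + real r * d}. norm (steklov r d f x - f x) \<le> 2 * (2 ^ r + 1) * norm (f y)" for x
    proof (rule ex_near_norm_le)
      fix B assume B: "\<And>y. y \<in> {x..x + real r * d} \<Longrightarrow> norm (f y) \<le> B"
      have "norm (steklov r d f x) \<le> 2 ^ r * B"
        by (rule steklov_dominated[OF d B])
      moreover have "norm (f x) \<le> B"
        using d by (intro B) auto
      ultimately show "norm (steklov r d f x - f x) \<le> (2 ^ r + 1) * B"
        using norm_triangle_ineq4[of "steklov r d f x" "f x"] by (simp add: distrib_right)
    qed (use d in \<open>auto intro: add_pos_pos\<close>)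
  qed (use p in auto)
qed

text \<open>
  The difference of order \<open>r\<close> with step \<open>\<sigma> / r\<close> has the terms \<open>f (x + k * \<sigma> / r)\<close> for \<open>k = 0, \<dots>, r\<close>. Those
  with \<open>k \<ge> 1\<close> make up the Steklov average, with the opposite sign, and the term with \<open>k = 0\<close> contributes
  \<open>f x\<close> itself.
\<close>
lemma minus_steklov_eq_iterated_difference:
  fixes g :: "real \<Rightarrow> 'a::{real_normed_field, euclidean_space}"
  assumes g: "g \<in> bounded_borel" and d: "0 < d" and r: "0 < r"
  shows "g x - steklov r d g x =
    ((- d) powi (- int r)) *\<^sub>R iterated_integral d r (\<lambda>ts. difference r (sum_list ts / real r) g x)"
proof -
  define e where "e = (- d) powi (- int r)"
  let ?S = "\<lambda>m. (window_integral d (real m / real r) ^^ r) g x"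
  have const: "(window_integral d 0 ^^ n) g x = d ^ n *\<^sub>R g x" for n
  proof (induction n)
    case (Suc n)
    then show ?case
      using d by (simp add: window_integral_def set_lebesgue_integral_def)
  qed simp
  have "iterated_integral d r (\<lambda>ts. difference r (sum_list ts / real r) g x)
      = iterated_integral d r (\<lambda>ts. \<Sum>k=0..r. (of_nat (r choose k) * (-1) ^ (r - k)) * g (x + real k / real r * sum_list ts))"
    by (simp add: difference_def)
  also have "\<dots> = (\<Sum>k=0..r. (of_nat (r choose k) * (-1) ^ (r - k)) * ?S k)"
    using g d by (intro iterated_integral_eq_window_integral) auto
  also have "\<dots> = (-1) ^ r * (d ^ r *\<^sub>R g x) + (\<Sum>m=1..r. (of_nat (r choose m) * (-1) ^ (r - m)) * ?S m)"
    by (subst sum.atLeast_Suc_atMost) (auto simp: const)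
  also have "(\<Sum>m=1..r. (of_nat (r choose m) * (-1) ^ (r - m)) * ?S m)
      = - (\<Sum>m=1..r. steklov_coeff r m * ?S m)"
    by (simp add: sum_negf[symmetric] mult.commute mult.left_commute)
  finally have I: "iterated_integral d r (\<lambda>ts. difference r (sum_list ts / real r) g x)
      = (-1) ^ r * (d ^ r *\<^sub>R g x) - (\<Sum>m=1..r. steklov_coeff r m * ?S m)"
    by simp
  have "e *\<^sub>R ((-1) ^ r * (d ^ r *\<^sub>R g x)) = (e * (- d) ^ r) *\<^sub>R g x"
    by (simp add: scaleR_conv_of_real power_minus[of d] mult_ac)
  also have "e * (- d) ^ r = 1"
    using d by (simp add: e_def power_int_minus)
  finally have "e *\<^sub>R ((-1) ^ r * (d ^ r *\<^sub>R g x)) = g x"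
    by simp
  then show ?thesis
    unfolding I steklov_eq_window_integral[OF g d] e_def[symmetric]
    by (simp add: scaleR_diff_right)
qed

text \<open>
  The step \<open>u / r\<close> stays in \<open>{0..d}\<close> when \<open>u\<close> is a sum of \<open>r\<close> numbers in \<open>{0..d}\<close>. So each slice of the
  integrand is bounded by the modulus, and Minkowski's integral inequality applies; the volume
  \<open>d ^ r\<close> cancels the normalising factor.
\<close>
lemma Lp_norm_minus_steklov_le:
  fixes g :: "real \<Rightarrow> 'a::{real_normed_field, euclidean_space}"
  assumes p: "1 \<le> p" and g: "g \<in> bounded_borel" and d: "0 < d" and r: "0 < r"
  shows "Lp_norm p (\<lambda>x. g x - steklov r d g x) \<le> modulus r p g d"
proof -
  let ?K = "\<lambda>x u. difference r (u / real r) g x"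
  have [measurable]: "g \<in> borel_measurable borel"
    using g by (rule bounded_borel_measurable)
  obtain B where B: "0 \<le> B" "\<And>x. norm (g x) \<le> B"
    using bounded_borel_bound[OF g] by blast
  have "case_prod ?K \<in> borel_measurable (borel \<Otimes>\<^sub>M borel)"
    unfolding difference_def by measurable
  then have K: "case_prod ?K \<in> borel_measurable borel"
    by (simp add: borel_prod)
  have KB: "norm (?K x u) \<le> (\<Sum>k=0..r. real (r choose k) * B)" for x u
    unfolding difference_def
    by (intro sum_norm_le) (auto simp: norm_mult norm_power intro!: mult_left_mono B)
  have slice: "Lp_norm p (\<lambda>x. ?K x v) \<le> modulus r p g d" if "0 \<le> v" "v \<le> 0 + real r * d" for v
  proof (cases "v = 0")
    case True
    then show ?thesis
      using Lp_norm_zero[OF p, where ?'a = 'a] r by (simp add: difference_zero_step)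
  next
    case False
    then have "v / real r \<in> {0<..d}"
      using that r by (auto simp: field_simps)
    then show ?thesis
      unfolding modulus_def by (rule SUP_upper)
  qed
  have "Lp_norm p (\<lambda>x. g x - steklov r d g x)
      \<le> ennreal \<bar>(- d) powi (- int r)\<bar> * Lp_norm p (\<lambda>x. iterated_integral d r (\<lambda>ts. ?K x (0 + sum_list ts)))"
    unfolding minus_steklov_eq_iterated_difference[OF g d r] add_0 by (rule Lp_norm_scaleR_le[OF p])
  also have "\<dots> \<le> ennreal \<bar>(- d) powi (- int r)\<bar> * (ennreal (d ^ r) * modulus r p g d)"
    using B by (intro mult_left_mono Lp_norm_iterated_integral_le[OF p d K _ KB slice] sum_nonneg) auto
  also have "\<dots> = modulus r p g d"
  proof -
    have "\<bar>(- d) powi (- int r)\<bar> * d ^ r = 1"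
      using abs_powi_minus[OF d, of r] d by simp
    then show ?thesis
      using d by (simp flip: mult.assoc ennreal_mult)
  qed
  finally show ?thesis .
qed

section \<open>Smoothness of Steklov averages\<close>

lemma lipschitz_imp_locally_abs_continuous:
  assumes L: "\<And>x y. norm (h x - h y) \<le> L * \<bar>x - y\<bar>"
  shows "locally_abs_continuous h"
  unfolding locally_abs_continuous_def abs_continuous_on_interval_def
proof (intro allI impI)
  fix a b \<epsilon> :: real assume "0 < \<epsilon>"
  have "0 \<le> L"
    using order.trans[OF norm_ge_zero L[of 1 0]] by simp
  show "\<exists>\<delta>>0. \<forall>(n::nat) u v. (\<forall>i<n. a \<le> u i \<and> u i \<le> v i \<and> v i \<le> b) \<and>
      disjoint_family_on (\<lambda>i. {u i<..<v i}) {..<n} \<and> (\<Sum>i<n. v i - u i) < \<delta>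
      \<longrightarrow> (\<Sum>i<n. norm (h (v i) - h (u i))) < \<epsilon>"
  proof (intro exI[of _ "\<epsilon> / (L + 1)"] conjI allI impI)
    show "0 < \<epsilon> / (L + 1)"
      using \<open>0 < \<epsilon>\<close> \<open>0 \<le> L\<close> by simp
    fix n :: nat and u v :: "nat \<Rightarrow> real"
    assume *: "(\<forall>i<n. a \<le> u i \<and> u i \<le> v i \<and> v i \<le> b) \<and>
      disjoint_family_on (\<lambda>i. {u i<..<v i}) {..<n} \<and> (\<Sum>i<n. v i - u i) < \<epsilon> / (L + 1)"
    have "(\<Sum>i<n. norm (h (v i) - h (u i))) \<le> (\<Sum>i<n. (L + 1) * (v i - u i))"
    proof (rule sum_mono)
      fix i assume "i \<in> {..<n}"
      then have "u i \<le> v i"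
        using * by auto
      then show "norm (h (v i) - h (u i)) \<le> (L + 1) * (v i - u i)"
        using L[of "v i" "u i"] by (simp add: distrib_right)
    qed
    also have "\<dots> = (L + 1) * (\<Sum>i<n. v i - u i)"
      by (simp add: sum_distrib_left)
    also have "\<dots> < \<epsilon>"
      using * \<open>0 \<le> L\<close> by (simp add: field_simps)
    finally show "(\<Sum>i<n. norm (h (v i) - h (u i))) < \<epsilon>" .
  qed
qed

text \<open>
  The derivative of order \<open>j\<close> of the Steklov average, in closed form: \<open>j\<close> of the \<open>r\<close> window integrals
  are turned into difference quotients.
\<close>
definition steklov_deriv ::
    "nat \<Rightarrow> real \<Rightarrow> (real \<Rightarrow> 'a::{real_normed_field, euclidean_space}) \<Rightarrow> nat \<Rightarrow> real \<Rightarrow> 'a" where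
  "steklov_deriv r d g j x = (\<Sum>m=1..r. of_real ((- d) powi (- int r)) * steklov_coeff r m *
     (window_integral d (real m / real r) ^^ (r - j)) ((window_quotient d (real m / real r) ^^ j) g) x)"

lemma steklov_deriv_0:
  assumes "g \<in> bounded_borel" "0 < d"
  shows "steklov_deriv r d g 0 = steklov r d g"
  using steklov_eq_window_integral[OF assms]
  by (simp add: fun_eq_iff steklov_deriv_def scaleR_conv_of_real sum_distrib_left mult.assoc)

lemma steklov_deriv_measurable:
  assumes "g \<in> bounded_borel" "0 < d"
  shows "steklov_deriv r d g j \<in> borel_measurable borel"
  unfolding steklov_deriv_def using assms
  by (intro borel_measurable_sum borel_measurable_times borel_measurable_const
      bounded_borel_measurable window_funpow_bounded_borel) auto

lemma funpow_window_integral_Suc_diff: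
  assumes "j < r"
  shows "(window_integral d c ^^ (r - j)) q = window_integral d c ((window_integral d c ^^ (r - Suc j)) q)"
proof -
  have "r - j = Suc (r - Suc j)"
    using assms by simp
  then show ?thesis
    by simp
qed

lemma steklov_deriv_lipschitz:
  assumes g: "g \<in> bounded_borel" and d: "0 < d" and "j < r"
  shows "\<exists>L. \<forall>x y. norm (steklov_deriv r d g j x - steklov_deriv r d g j y) \<le> L * \<bar>x - y\<bar>"
proof -
  define T where "T m = (window_integral d (real m / real r) ^^ (r - j)) ((window_quotient d (real m / real r) ^^ j) g)" for m
  define a :: "nat \<Rightarrow> 'a" where "a m = of_real ((- d) powi (- int r)) * steklov_coeff r m" for m
  have D: "steklov_deriv r d g j x = (\<Sum>m=1..r. a m * T m x)" for x
    by (simp only: steklov_deriv_def a_def T_def)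
  have "\<exists>L. \<forall>x y. norm (T m x - T m y) \<le> L * \<bar>x - y\<bar>" if "m \<in> {1..r}" for m
  proof -
    have c: "0 < real m / real r"
      using that by simp
    show ?thesis
      unfolding T_def funpow_window_integral_Suc_diff[OF \<open>j < r\<close>]
      using window_integral_lipschitz[OF c less_imp_le[OF d]
          window_funpow_bounded_borel(1)[OF window_funpow_bounded_borel(2)[OF g less_imp_le[OF d]] less_imp_le[OF d]]]
      by metis
  qed
  then obtain L where L: "\<And>m x y. m \<in> {1..r} \<Longrightarrow> norm (T m x - T m y) \<le> L m * \<bar>x - y\<bar>"
    by metis
  have "norm (steklov_deriv r d g j x - steklov_deriv r d g j y) \<le> (\<Sum>m=1..r. norm (a m) * L m) * \<bar>x - y\<bar>" for x y
  proof -
    have "steklov_deriv r d g j x - steklov_deriv r d g j y = (\<Sum>m=1..r. a m * (T m x - T m y))"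
      by (simp only: D right_diff_distrib sum_subtractf)
    also have "norm \<dots> \<le> (\<Sum>m=1..r. norm (a m) * (L m * \<bar>x - y\<bar>))"
      using L by (intro sum_norm_le) (auto simp: norm_mult intro!: mult_left_mono)
    finally show ?thesis
      by (simp add: sum_distrib_right mult.assoc)
  qed
  then show ?thesis
    by blast
qed

text \<open>
  Differentiate the outermost window integral and commute the resulting quotient past the remaining
  ones. If \<open>Suc j < r\<close>, at least one integral remains inside, so the integrand is continuous and the
  derivative exists everywhere.
\<close>
lemma steklov_deriv_has_derivative:
  assumes g: "g \<in> bounded_borel" and d: "0 < d" and j: "j < r"
  shows "AE x in lebesgue. (steklov_deriv r d g j has_vector_derivative steklov_deriv r d g (Suc j) x) (at x)"
    and "Suc j < r \<Longrightarrow> (steklov_deriv r d g j has_vector_derivative steklov_deriv r d g (Suc j) x) (at x)"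
proof -
  let ?c = "\<lambda>m. real m / real r"
  let ?q = "\<lambda>m. (window_quotient d (?c m) ^^ j) g"
  let ?U = "\<lambda>m. (window_integral d (?c m) ^^ (r - Suc j)) (?q m)"
  note d' = less_imp_le[OF d]
  have q: "?q m \<in> bounded_borel" for m
    by (rule window_funpow_bounded_borel(2)[OF g d'])
  have U: "?U m \<in> bounded_borel" for m
    by (rule window_funpow_bounded_borel(1)[OF q d'])
  have Q: "window_quotient d (?c m) (?U m)
      = (window_integral d (?c m) ^^ (r - Suc j)) ((window_quotient d (?c m) ^^ Suc j) g)" for m
    using window_quotient_funpow_commute[OF q d'] by simp
  have sum: "(steklov_deriv r d g j has_vector_derivative steklov_deriv r d g (Suc j) x) (at x)"
    if "\<And>m. m \<in> {1..r} \<Longrightarrow>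
      (window_integral d (?c m) (?U m) has_vector_derivative window_quotient d (?c m) (?U m) x) (at x)" for x
    unfolding steklov_deriv_def[abs_def] funpow_window_integral_Suc_diff[OF j] Q[symmetric]
    using that
    by (intro has_vector_derivative_sum bounded_linear.has_vector_derivative[OF bounded_linear_mult_right])
  have "AE x in lebesgue. \<forall>m\<in>{1..r}.
      (window_integral d (?c m) (?U m) has_vector_derivative window_quotient d (?c m) (?U m) x) (at x)"
    using d by (intro AE_finite_allI window_integral_has_derivative(1) U) auto
  then show "AE x in lebesgue. (steklov_deriv r d g j has_vector_derivative steklov_deriv r d g (Suc j) x) (at x)"
    by eventually_elim (rule sum, blast)
  assume "Suc j < r"
  have "isCont (?U m) y" if m: "m \<in> {1..r}" for m y
    unfolding funpow_window_integral_Suc_diff[OF \<open>Suc j < r\<close>]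
    using m by (intro window_integral_isCont window_funpow_bounded_borel(1)[OF q] d') auto
  then show "(steklov_deriv r d g j has_vector_derivative steklov_deriv r d g (Suc j) x) (at x)"
    using d by (intro sum window_integral_has_derivative(2) U) auto
qed

lemma nth_deriv_steklov:
  assumes g: "g \<in> bounded_borel" and d: "0 < d" and "j < r"
  shows "nth_deriv j (steklov r d g) = steklov_deriv r d g j"
  using \<open>j < r\<close>
proof (induction j)
  case 0
  then show ?case
    using steklov_deriv_0[OF g d] by (simp add: nth_deriv_def)
next
  case (Suc j)
  then have "nth_deriv (Suc j) (steklov r d g) = (\<lambda>x. vector_derivative (steklov_deriv r d g j) (at x))"
    by (simp add: nth_deriv_def)
  then show ?case
    using steklov_deriv_has_derivative(2)[OF g d _ Suc.prems] Suc.prems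
    by (auto intro!: ext vector_derivative_at)
qed

lemma nth_deriv_steklov_AE:
  assumes g: "g \<in> bounded_borel" and d: "0 < d" and s: "1 \<le> s" "s \<le> r"
  shows "AE x in lebesgue. nth_deriv s (steklov r d g) x = steklov_deriv r d g s x"
proof -
  obtain j where j: "s = Suc j" "j < r"
    using s by (cases s) auto
  have "nth_deriv s (steklov r d g) = (\<lambda>x. vector_derivative (steklov_deriv r d g j) (at x))"
    using nth_deriv_steklov[OF g d j(2)] by (simp add: nth_deriv_def j(1))
  then show ?thesis
    using steklov_deriv_has_derivative(1)[OF g d j(2)] unfolding j(1)
    by (auto elim!: eventually_mono simp: vector_derivative_at)
qed

lemma ennreal_mult_assoc3:
  assumes "0 \<le> a" "0 \<le> b" "0 \<le> c"
  shows "ennreal a * (ennreal b * (ennreal c * x)) = ennreal (a * b * c) * x"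
  using assms by (simp add: ennreal_mult mult.assoc)

text \<open>
  The factor \<open>r / m\<close> is the reciprocal of \<open>c = m / r\<close> and enters once for every difference quotient.
\<close>
definition steklov_const :: "nat \<Rightarrow> nat \<Rightarrow> real" where
  "steklov_const r s = (\<Sum>m=1..r. real (r choose m) * (real r / real m) ^ s)"

text \<open>
  Each of the \<open>r - s\<close> remaining integrals costs a factor \<open>d\<close>, the \<open>s\<close> difference quotients form a
  difference of order \<open>s\<close> with step \<open>m * d / r \<le> d\<close>, and the normalising factor is \<open>1 / d ^ r\<close>.
\<close>
lemma Lp_norm_steklov_deriv_le:
  fixes g :: "real \<Rightarrow> 'a::{real_normed_field, euclidean_space}"
  assumes p: "1 \<le> p" and g: "g \<in> bounded_borel" and d: "0 < d" and s: "s \<le> r"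
  shows "Lp_norm p (steklov_deriv r d g s) \<le> ennreal (steklov_const r s / d ^ s) * modulus s p g d"
proof -
  let ?c = "\<lambda>m. real m / real r"
  let ?q = "\<lambda>m. (window_quotient d (?c m) ^^ s) g"
  let ?a = "\<lambda>m. of_real ((- d) powi (- int r)) * steklov_coeff r m :: 'a"
  have a: "norm (?a m) = real (r choose m) / d ^ r" for m
    unfolding norm_mult norm_power norm_of_real norm_minus_cancel norm_one norm_of_nat abs_powi_minus[OF d]
    by simp
  have q: "Lp_norm p (?q m) \<le> ennreal (1 / ?c m ^ s) * modulus s p g d" if m: "m \<in> {1..r}" for m
  proof -
    have c: "0 < ?c m" "?c m \<le> 1"
      using m by auto
    then have "?c m * d \<in> {0<..d}"
      using d mult_right_mono[OF c(2), of d] mult_pos_pos[OF c(1) d] by simp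
    then have "Lp_norm p (difference s (?c m * d) g) \<le> modulus s p g d"
      unfolding modulus_def by (rule SUP_upper)
    moreover have "Lp_norm p (?q m) \<le> ennreal \<bar>1 / ?c m ^ s\<bar> * Lp_norm p (difference s (?c m * d) g)"
      unfolding window_quotient_funpow_eq_difference[abs_def] by (rule Lp_norm_scaleR_le[OF p])
    ultimately show ?thesis
      using c by (simp add: order.trans mult_left_mono)
  qed
  have "Lp_norm p (steklov_deriv r d g s)
      \<le> (\<Sum>m=1..r. Lp_norm p (\<lambda>x. ?a m * (window_integral d (?c m) ^^ (r - s)) (?q m) x))"
    unfolding steklov_deriv_def[abs_def] by (intro Lp_norm_sum p) simp
  also have "\<dots> \<le> (\<Sum>m=1..r. ennreal (real (r choose m) * (real r / real m) ^ s / d ^ s) * modulus s p g d)"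
  proof (rule sum_mono)
    fix m assume m: "m \<in> {1..r}"
    have "Lp_norm p (\<lambda>x. ?a m * (window_integral d (?c m) ^^ (r - s)) (?q m) x)
        \<le> ennreal (norm (?a m)) * Lp_norm p ((window_integral d (?c m) ^^ (r - s)) (?q m))"
      by (rule Lp_norm_cmult_le[OF p])
    also have "\<dots> \<le> ennreal (norm (?a m)) * (ennreal (d ^ (r - s)) * (ennreal (1 / ?c m ^ s) * modulus s p g d))"
      using window_funpow_bounded_borel(2)[OF g less_imp_le[OF d]]
      by (intro mult_left_mono order.trans[OF Lp_norm_window_integral_funpow_le[OF p d] mult_left_mono[OF q[OF m]]]) auto
    also have "\<dots> = ennreal (norm (?a m) * d ^ (r - s) * (1 / ?c m ^ s)) * modulus s p g d"
      using d by (intro ennreal_mult_assoc3) auto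
    also have "norm (?a m) * d ^ (r - s) * (1 / ?c m ^ s) = real (r choose m) * (real r / real m) ^ s / d ^ s"
    proof -
      have "d ^ r = d ^ (r - s) * d ^ s"
        using s by (simp flip: power_add)
      then have "real (r choose m) / d ^ r * d ^ (r - s) = real (r choose m) / d ^ s"
        using d by simp
      then show ?thesis
        unfolding a by (simp add: power_divide)
    qed
    finally show "Lp_norm p (\<lambda>x. ?a m * (window_integral d (?c m) ^^ (r - s)) (?q m) x)
        \<le> ennreal (real (r choose m) * (real r / real m) ^ s / d ^ s) * modulus s p g d" .
  qed
  also have "\<dots> = ennreal (steklov_const r s / d ^ s) * modulus s p g d"
  proof -
    have "(\<Sum>m=1..r. ennreal (real (r choose m) * (real r / real m) ^ s / d ^ s)) = ennreal (steklov_const r s / d ^ s)"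
      unfolding steklov_const_def sum_divide_distrib using d by (intro sum_ennreal) auto
    then show ?thesis
      by (simp only: sum_distrib_right[symmetric])
  qed
  finally show ?thesis .
qed

lemma steklov_nth_deriv_bound:
  fixes g :: "real \<Rightarrow> 'a::{real_normed_field, euclidean_space}"
  assumes p: "1 \<le> p" and g: "g \<in> bounded_borel" and d: "0 < d" and s: "1 \<le> s" "s \<le> r"
  shows "Lp_norm p (nth_deriv s (steklov r d g)) \<le> ennreal (steklov_const r s / d ^ s) * modulus s p g d"
proof -
  have m: "steklov_deriv r d g s \<in> borel_measurable lebesgue"
    by (intro borel_imp_lebesgue_measurable steklov_deriv_measurable g d)
  have ae: "AE x in lebesgue. steklov_deriv r d g s x = nth_deriv s (steklov r d g) x"
    using nth_deriv_steklov_AE[OF g d s] by eventually_elim simp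
  have "Lp_norm p (nth_deriv s (steklov r d g)) = Lp_norm p (steklov_deriv r d g s)"
    using borel_measurable_AE[OF m ae] m ae by (intro Lp_norm_cong_AE[symmetric])
  then show ?thesis
    using Lp_norm_steklov_deriv_le[OF p g d s(2)] by simp
qed

lemma steklov_in_sobolev:
  fixes g :: "real \<Rightarrow> 'a::{real_normed_field, euclidean_space}"
  assumes p: "1 \<le> p" and g: "g \<in> bounded_borel" and gp: "in_Lp p g" and d: "0 < d"
    and s: "1 \<le> s" "s \<le> r"
  shows "steklov r d g \<in> sobolev s p"
proof -
  have "Lp_norm p (\<lambda>x. g x - (g x - steklov r d g x)) \<le> Lp_norm p g + Lp_norm p (\<lambda>x. g x - steklov r d g x)"
    by (rule Lp_norm_diff[OF p])
  also have "\<dots> \<le> Lp_norm p g + modulus r p g d"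
    using s by (intro add_left_mono Lp_norm_minus_steklov_le p g d) auto
  also have "\<dots> < \<infinity>"
    using gp modulus_less_top[OF p gp] by (simp add: in_Lp_def)
  finally have 1: "in_Lp p (steklov r d g)"
    by (simp add: in_Lp_def)
  have 2: "nth_deriv j (steklov r d g) differentiable (at x)" if "Suc j < s" for j x
    using nth_deriv_steklov[OF g d, of j r] steklov_deriv_has_derivative(2)[OF g d, of j r] that s
    by (auto simp: differentiable_def has_vector_derivative_def)
  have 3: "locally_abs_continuous (nth_deriv j (steklov r d g))" if "j < s" for j
    using nth_deriv_steklov[OF g d, of j r] steklov_deriv_lipschitz[OF g d, of j r] that s
    by (auto intro: lipschitz_imp_locally_abs_continuous)
  have "Lp_norm p (nth_deriv s (steklov r d g)) < \<infinity>"
    using modulus_less_top[OF p gp, of s d]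
    by (intro le_less_trans[OF steklov_nth_deriv_bound[OF p g d s]]) (simp add: ennreal_mult_less_top)
  then have 4: "in_Lp p (nth_deriv s (steklov r d g))"
    by (simp add: in_Lp_def)
  show ?thesis
    using 1 2 3 4 by (simp add: sobolev_def)
qed

section \<open>The error of sampling operators\<close>

text \<open>
  What the main argument needs to know about Steklov averages. The analytic estimates are proved for a
  bounded Borel representative of \<open>f\<close>. Membership in \<open>Lambda_space\<close>, however, depends on the values of
  \<open>f\<close> at individual points and must be derived from \<open>f\<close> itself; the Steklov average is the same for both.
\<close>
lemma steklov_approximation:
  fixes f :: "real \<Rightarrow> 'a::{real_normed_field, euclidean_space}"
  assumes p: "1 \<le> p" and f: "f \<in> Lambda_space p" and d: "0 < d" and s: "1 \<le> s" "s \<le> r"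
  shows "steklov r d f \<in> sobolev s p"
    and "steklov r d f \<in> Lambda_space p"
    and "(\<lambda>x. steklov r d f x - f x) \<in> Lambda_space p"
    and "Lp_norm p (\<lambda>x. f x - steklov r d f x) \<le> 2 ^ (r - s) * modulus s p f d"
    and "Lp_norm p (nth_deriv s (steklov r d f)) \<le> ennreal (steklov_const r s / d ^ s) * modulus s p f d"
proof -
  have fb: "f \<in> bounded_measurable"
    using f by (simp add: Lambda_space_def)
  then have fm: "f \<in> borel_measurable lebesgue"
    by (simp add: bounded_measurable_def)
  have fp: "in_Lp p f"
    by (rule Lambda_space_in_Lp[OF p f])
  obtain g where g: "g \<in> bounded_borel" and ae: "AE x in lebesgue. f x = g x"
    by (rule bounded_measurable_ex_bounded_borel[OF fb])
  have gm: "g \<in> borel_measurable lebesgue"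
    by (intro borel_imp_lebesgue_measurable bounded_borel_measurable g)
  have gp: "in_Lp p g"
    using fp Lp_norm_cong_AE[OF fm gm ae] by (simp add: in_Lp_def)
  have St: "steklov r d f = steklov r d g"
    using s by (intro steklov_cong_AE fm gm ae) auto
  have mod: "modulus n p f d = modulus n p g d" for n
    by (rule modulus_cong_AE[OF fm gm ae])
  show sob: "steklov r d f \<in> sobolev s p"
    unfolding St by (rule steklov_in_sobolev[OF p g gp d s])
  then have Sm: "steklov r d f \<in> borel_measurable lebesgue"
    by (auto simp: sobolev_def intro: in_Lp_measurable)
  show "steklov r d f \<in> Lambda_space p" "(\<lambda>x. steklov r d f x - f x) \<in> Lambda_space p"
    by (rule steklov_in_Lambda_space[OF p f d Sm])+
  show "Lp_norm p (nth_deriv s (steklov r d f)) \<le> ennreal (steklov_const r s / d ^ s) * modulus s p f d"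
    unfolding St mod by (rule steklov_nth_deriv_bound[OF p g d s])
  have "Lp_norm p (\<lambda>x. f x - steklov r d f x) = Lp_norm p (\<lambda>x. g x - steklov r d g x)"
    using ae unfolding St
    by (intro Lp_norm_cong_AE borel_measurable_diff fm gm Sm[unfolded St]) (auto elim: eventually_mono)
  also have "\<dots> \<le> modulus (s + (r - s)) p g d"
    using Lp_norm_minus_steklov_le[OF p g d] s by simp
  also have "\<dots> \<le> 2 ^ (r - s) * modulus s p g d"
    by (rule modulus_add_le[OF p gm])
  finally show "Lp_norm p (\<lambda>x. f x - steklov r d f x) \<le> 2 ^ (r - s) * modulus s p f d"
    unfolding mod .
qed

text \<open>
  The three series converge, so this is the uniqueness of limits.
\<close>
lemma sampling_operators_diff:
  assumes G: "sampling_operators p node \<phi> G" and "0 < W"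
    and "f \<in> Lambda_space p" "g \<in> Lambda_space p" "(\<lambda>x. f x - g x) \<in> Lambda_space p"
  shows "G W (\<lambda>x. f x - g x) x = G W f x - G W g x"
proof -
  have lim: "bilateral_sums (\<lambda>k. h (node W k) * \<phi> W k x) (G W h x)" if "h \<in> Lambda_space p" for h
    using G \<open>0 < W\<close> that by (auto simp: sampling_operators_def)
  have "bilateral_sums (\<lambda>k. (f (node W k) - g (node W k)) * \<phi> W k x) (G W f x - G W g x)"
    using tendsto_diff[OF lim[OF assms(3), unfolded bilateral_sums_def] lim[OF assms(4), unfolded bilateral_sums_def]]
    by (simp add: bilateral_sums_def split_beta' left_diff_distrib sum_subtractf)
  moreover have "sequentially \<times>\<^sub>F sequentially \<noteq> bot"
    by (simp add: prod_filter_eq_bot)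
  ultimately show ?thesis
    using lim[OF assms(5)] unfolding bilateral_sums_def by (intro tendsto_unique)
qed

theorem theorem3p4:
  fixes r s :: nat and p K1 K3 :: real
    and node :: "real \<Rightarrow> int \<Rightarrow> real"
    and \<phi> :: "real \<Rightarrow> int \<Rightarrow> real \<Rightarrow> 'a::{real_normed_field, euclidean_space}"
    and G :: "real \<Rightarrow> (real \<Rightarrow> 'a) \<Rightarrow> real \<Rightarrow> 'a"
  assumes "1 \<le> s" "s \<le> r" "1 \<le> p"
    and "sampling_operators p node \<phi> G"
    and "K1 > 0" "K3 > 0"
    and "\<And>W f. W > 0 \<Longrightarrow> f \<in> Lambda_space p \<Longrightarrow>
           Lp_norm p (G W f) \<le> ennreal K1 * lp_norm p (grid W) f"
    and "\<And>W f. W > 0 \<Longrightarrow> f \<in> sobolev s p \<Longrightarrow>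
           Lp_norm p (\<lambda>x. f x - G W f x)
             \<le> ennreal (K3 * W powi (- int s)) * Lp_norm p (nth_deriv s f)"
  shows "\<exists>C1>0.
    (\<forall>f\<in>Lambda_space p. \<forall>W>0.
       Lp_norm p (\<lambda>x. f x - G W f x)
         \<le> ennreal K1 * lp_norm p (grid W) (\<lambda>x. steklov r (1 / W) f x - f x)
            + ennreal C1 * modulus s p f (1 / W)) \<and>
    (\<forall>f\<in>Lambda_space p. \<forall>W>0.
       Lp_norm p (\<lambda>x. f x - G W f x)
         \<le> ennreal (max K1 C1) * semidiscrete_modulus r s p f (1 / W) (grid W)) \<and>
    (\<forall>K2>0.
       (\<forall>f\<in>Lambda_space p. \<forall>W>0.
          ennreal K2 * lp_norm p (grid W) f \<le> Lp_norm p (G W f)) \<longrightarrow>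
       (\<forall>f\<in>Lambda_space p. \<forall>W>0.
          ennreal K2 * lp_norm p (grid W) (\<lambda>x. steklov r (1 / W) f x - f x)
            - ennreal C1 * modulus s p f (1 / W)
            \<le> Lp_norm p (\<lambda>x. f x - G W f x)))"
proof -
  note s = assms(1,2) and p = assms(3) and samp = assms(4) and K = assms(5,6)
  (* The two summands come from f - S and from S - G S. *)
  define C1 where "C1 = 2 ^ (r - s) + K3 * steklov_const r s"
  have const: "0 \<le> steklov_const r s"
    unfolding steklov_const_def by (intro sum_nonneg) auto
  have C1: "0 < C1"
    unfolding C1_def using K const by (intro add_pos_nonneg) auto
  have core: "Lp_norm p (\<lambda>x. f x - steklov r (1 / W) f x)
        + Lp_norm p (\<lambda>x. steklov r (1 / W) f x - G W (steklov r (1 / W) f) x)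
      \<le> ennreal C1 * modulus s p f (1 / W)"
    and lin: "G W (\<lambda>x. steklov r (1 / W) f x - f x) x = G W (steklov r (1 / W) f) x - G W f x"
    if f: "f \<in> Lambda_space p" and W: "0 < W" for f :: "real \<Rightarrow> 'a" and W x
  proof -
    let ?S = "steklov r (1 / W) f" and ?m = "modulus s p f (1 / W)"
    have d: "0 < 1 / W"
      using W by simp
    note S = steklov_approximation[OF p f d s]
    show "G W (\<lambda>x. ?S x - f x) x = G W ?S x - G W f x"
      by (rule sampling_operators_diff[OF samp W S(2) f S(3)])
    have "Lp_norm p (\<lambda>x. ?S x - G W ?S x) \<le> ennreal (K3 * W powi (- int s)) * Lp_norm p (nth_deriv s ?S)"
      by (rule assms(8)[OF W S(1)])
    also have "\<dots> \<le> ennreal (K3 * W powi (- int s)) * (ennreal (steklov_const r s / (1 / W) ^ s) * ?m)"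
      by (intro mult_left_mono S(5)) simp
    also have "\<dots> = ennreal (K3 * W powi (- int s) * (steklov_const r s / (1 / W) ^ s)) * ?m"
    proof -
      have "ennreal (K3 * W powi (- int s)) * ennreal (steklov_const r s / (1 / W) ^ s)
          = ennreal (K3 * W powi (- int s) * (steklov_const r s / (1 / W) ^ s))"
        using K W const by (intro ennreal_mult[symmetric] mult_nonneg_nonneg divide_nonneg_nonneg) auto
      then show ?thesis
        by (simp only: mult.assoc[symmetric])
    qed
    also have "K3 * W powi (- int s) * (steklov_const r s / (1 / W) ^ s) = K3 * steklov_const r s"
      using W by (simp add: power_int_minus power_divide field_simps)
    finally have "Lp_norm p (\<lambda>x. ?S x - G W ?S x) \<le> ennreal (K3 * steklov_const r s) * ?m" .
    then have "Lp_norm p (\<lambda>x. f x - ?S x) + Lp_norm p (\<lambda>x. ?S x - G W ?S x)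
        \<le> 2 ^ (r - s) * ?m + ennreal (K3 * steklov_const r s) * ?m"
      using S(4) by (intro add_mono)
    also have "\<dots> = ennreal C1 * ?m"
      using K const by (simp add: C1_def distrib_right ennreal_power flip: ennreal_numeral)
    finally show "Lp_norm p (\<lambda>x. f x - ?S x) + Lp_norm p (\<lambda>x. ?S x - G W ?S x) \<le> ennreal C1 * ?m" .
  qed
  have upper: "Lp_norm p (\<lambda>x. f x - G W f x)
      \<le> ennreal K1 * lp_norm p (grid W) (\<lambda>x. steklov r (1 / W) f x - f x) + ennreal C1 * modulus s p f (1 / W)"
    if f: "f \<in> Lambda_space p" and W: "0 < W" for f W
  proof -
    let ?S = "steklov r (1 / W) f"
    have d: "0 < 1 / W"
      using W by simp
    have "Lp_norm p (\<lambda>x. f x - G W f x)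
        = Lp_norm p (\<lambda>x. G W (\<lambda>x. ?S x - f x) x + ((f x - ?S x) + (?S x - G W ?S x)))"
      unfolding lin[OF f W] by simp
    also have "\<dots> \<le> Lp_norm p (G W (\<lambda>x. ?S x - f x))
        + (Lp_norm p (\<lambda>x. f x - ?S x) + Lp_norm p (\<lambda>x. ?S x - G W ?S x))"
      by (intro order.trans[OF Lp_norm_add[OF p]] add_left_mono Lp_norm_add[OF p])
    also have "\<dots> \<le> ennreal K1 * lp_norm p (grid W) (\<lambda>x. ?S x - f x) + ennreal C1 * modulus s p f (1 / W)"
      by (intro add_mono core f W assms(7) steklov_approximation(3)[OF p f d s])
    finally show ?thesis .
  qed
  have combined: "Lp_norm p (\<lambda>x. f x - G W f x)
      \<le> ennreal (max K1 C1) * semidiscrete_modulus r s p f (1 / W) (grid W)"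
    if f: "f \<in> Lambda_space p" and W: "0 < W" for f W
    unfolding semidiscrete_modulus_def distrib_left
    by (intro order.trans[OF upper[OF f W]] add_mono mult_right_mono ennreal_leI) auto
  have lower: "ennreal K2 * lp_norm p (grid W) (\<lambda>x. steklov r (1 / W) f x - f x)
        - ennreal C1 * modulus s p f (1 / W) \<le> Lp_norm p (\<lambda>x. f x - G W f x)"
    if "\<And>f W. f \<in> Lambda_space p \<Longrightarrow> 0 < W \<Longrightarrow> ennreal K2 * lp_norm p (grid W) f \<le> Lp_norm p (G W f)"
      and f: "f \<in> Lambda_space p" and W: "0 < W" for K2 f W
  proof -
    let ?S = "steklov r (1 / W) f"
    have d: "0 < 1 / W"
      using W by simp
    have "ennreal K2 * lp_norm p (grid W) (\<lambda>x. ?S x - f x) \<le> Lp_norm p (G W (\<lambda>x. ?S x - f x))"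
      by (intro that(1) W steklov_approximation(3)[OF p f d s])
    also have "\<dots> = Lp_norm p (\<lambda>x. (f x - G W f x) - ((f x - ?S x) + (?S x - G W ?S x)))"
      by (intro arg_cong[where f = "Lp_norm p"] ext) (simp add: lin[OF f W])
    also have "\<dots> \<le> Lp_norm p (\<lambda>x. f x - G W f x)
        + (Lp_norm p (\<lambda>x. f x - ?S x) + Lp_norm p (\<lambda>x. ?S x - G W ?S x))"
      by (intro order.trans[OF Lp_norm_diff[OF p]] add_left_mono Lp_norm_add[OF p])
    also have "\<dots> \<le> Lp_norm p (\<lambda>x. f x - G W f x) + ennreal C1 * modulus s p f (1 / W)"
      by (intro add_left_mono core f W)
    finally have "ennreal K2 * lp_norm p (grid W) (\<lambda>x. ?S x - f x)
        \<le> ennreal C1 * modulus s p f (1 / W) + Lp_norm p (\<lambda>x. f x - G W f x)"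
      by (simp add: add.commute)
    (* Subtraction of extended nonnegative reals can be undone only for a finite subtrahend. *)
    moreover have "ennreal C1 * modulus s p f (1 / W) \<noteq> \<infinity>"
      using modulus_less_top[OF p Lambda_space_in_Lp[OF p f], of s "1 / W"]
      by (simp add: ennreal_mult_eq_top_iff)
    ultimately show ?thesis
      by (simp add: ennreal_minus_le_iff)
  qed
  show ?thesis
  proof (rule exI[of _ C1], intro conjI ballI allI impI)
    show "0 < C1"
      by (rule C1)
  next
    fix f :: "real \<Rightarrow> 'a" and W :: real assume "f \<in> Lambda_space p" "0 < W"
    then show "Lp_norm p (\<lambda>x. f x - G W f x)
        \<le> ennreal K1 * lp_norm p (grid W) (\<lambda>x. steklov r (1 / W) f x - f x) + ennreal C1 * modulus s p f (1 / W)"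
      by (rule upper)
  next
    fix f :: "real \<Rightarrow> 'a" and W :: real assume "f \<in> Lambda_space p" "0 < W"
    then show "Lp_norm p (\<lambda>x. f x - G W f x)
        \<le> ennreal (max K1 C1) * semidiscrete_modulus r s p f (1 / W) (grid W)"
      by (rule combined)
  next
    fix K2 W :: real and f :: "real \<Rightarrow> 'a"
    assume K2: "\<forall>f\<in>Lambda_space p. \<forall>W>0. ennreal K2 * lp_norm p (grid W) f \<le> Lp_norm p (G W f)"
      and f: "f \<in> Lambda_space p" "0 < W"
    show "ennreal K2 * lp_norm p (grid W) (\<lambda>x. steklov r (1 / W) f x - f x)
        - ennreal C1 * modulus s p f (1 / W) \<le> Lp_norm p (\<lambda>x. f x - G W f x)"
      by (rule lower[OF _ f]) (use K2 in simp)
  qed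
qed

end
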